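(* Let $m\ge 3$ be an integer and $x,y\in\mathbb{R}^m$. Then the Clifford-Fourier kernel $K_{m}(x,y)=e^{i\frac{\pi}{2}\Gamma_{y}}e^{-i(x,y)}$ is given by \begin{align*} K_{m}(x,y)=&\frac{e^{-(x,y)}}{2}-\frac{|x||y|}{2}\int_{0}^{1}(1-u^{2})^{-1/2}J_{1}\big[|x||y|(1-u^{2})^{1/2}\big]u^{m/2-1}e^{-(x,y)u}\,du\\ &+\frac{m-2}{4}\int_{0}^{1}J_{0}\big[|x||y|(1-u^{2})^{1/2}\big]u^{m/2-2}e^{-(x,y)u}\,du +\frac{1}{2}\int_{0}^{1}(x\wedge y)J_{0}\big[|x||y|(1-u^{2})^{1/2}\big]u^{m/2-1}e^{-(x,y)u}\,du\\ &-e^{im\pi /2}\Big(\frac{e^{(x,y)}}{2}-\frac{|x||y|}{2}\int_{0}^{1}(1-u^{2})^{-1/2}J_{1}\big[|x||y|(1-u^{2})^{1/2}\big]u^{m/2-1}e^{(x,y)u}\,du\\ &\qquad-\frac{m-2}{4}\int_{0}^{1}J_{0}\big[|x||y|(1-u^{2})^{1/2}\big]u^{m/2-2}e^{(x,y)u}\,du +\frac{1}{2}\int_{0}^{1}(x\wedge y)J_{0}\big[|x||y|(1-u^{2})^{1/2}\big]u^{m/2-1}e^{(x,y)u}\,du \Big). \end{align*}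
   Context: $\mathcal{C}\ell_{0,m}$ is the real Clifford algebra generated by an orthonormal basis $e_1,\dots,e_m$ of $\mathbb{R}^m$ with $e_ie_j+e_je_i=-2\delta_{ij}$, complexified as $\mathbb{C}\otimes\mathcal{C}\ell_{0,m}$; vectors are embedded via $x=\sum_j x_je_j$. $(x,y)=\sum_j x_jy_j$, $|x|$ is the Euclidean norm, and $x\wedge y:=\sum_{j<k}e_je_k(x_jy_k-x_ky_j)$. The Gamma operator is $\Gamma_{y}:=-\sum_{j<k}e_{j}e_{k}(y_{j}\partial_{y_{k}}-y_{k}\partial_{y_{j}})$ and $e^{i\frac{\pi}{2}\Gamma_y}$ its operator exponential. $J_0,J_1$ are Bessel functions of the first kind. *)

theory Defs
  imports "HOL-Analysis.Analysis"
begin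

text \<open>Vectors of R^m are represented as functions nat => real; only the
components 1..m are used.\<close>

definition vinner :: "nat \<Rightarrow> (nat \<Rightarrow> real) \<Rightarrow> (nat \<Rightarrow> real) \<Rightarrow> real" where
  "vinner m x y = (\<Sum>j\<in>{1..m}. x j * y j)"

definition vnorm :: "nat \<Rightarrow> (nat \<Rightarrow> real) \<Rightarrow> real" where
  "vnorm m x = sqrt (\<Sum>j\<in>{1..m}. (x j)\<^sup>2)"

text \<open>Elements of the complexified Clifford algebra C (x) Cl_{0,m}: coefficient
functions on blades e_A = e_{a1} ... e_{ak} (a1 < ... < ak, A subset of {1..m}).\<close>

type_synonym cl = "nat set \<Rightarrow> complex"

definition cl_scalar :: "complex \<Rightarrow> cl" where
  "cl_scalar c = (\<lambda>A. if A = {} then c else 0)"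

definition cl_blade :: "nat set \<Rightarrow> cl" where
  "cl_blade B = (\<lambda>A. if A = B then 1 else 0)"

definition cl_add :: "cl \<Rightarrow> cl \<Rightarrow> cl" where
  "cl_add u v = (\<lambda>A. u A + v A)"

definition cl_sub :: "cl \<Rightarrow> cl \<Rightarrow> cl" where
  "cl_sub u v = (\<lambda>A. u A - v A)"

definition cl_smult :: "complex \<Rightarrow> cl \<Rightarrow> cl" where
  "cl_smult c u = (\<lambda>A. c * u A)"

text \<open>Sign in e_A e_B = sign A B * e_{A symdiff B}, with e_i e_j + e_j e_i = -2 delta_ij:
one factor -1 per inversion (a in A, b in B, a > b) and per common index (e_i^2 = -1).\<close>

definition blade_sign :: "nat set \<Rightarrow> nat set \<Rightarrow> complex" where
  "blade_sign A B = (-1) ^ (card {(a, b). a \<in> A \<and> b \<in> B \<and> b < a} + card (A \<inter> B))"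

definition cl_mult :: "nat \<Rightarrow> cl \<Rightarrow> cl \<Rightarrow> cl" where
  "cl_mult m u v = (\<lambda>C. \<Sum>A\<in>Pow {1..m}. \<Sum>B\<in>Pow {1..m}.
      if (A - B) \<union> (B - A) = C then blade_sign A B * u A * v B else 0)"

definition cl_wedge :: "nat \<Rightarrow> (nat \<Rightarrow> real) \<Rightarrow> (nat \<Rightarrow> real) \<Rightarrow> cl" where
  "cl_wedge m x y = (\<lambda>A. \<Sum>j\<in>{1..m}. \<Sum>k\<in>{j<..m}.
      complex_of_real (x j * y k - x k * y j) * cl_blade {j, k} A)"

definition pderiv_cl :: "nat \<Rightarrow> ((nat \<Rightarrow> real) \<Rightarrow> cl) \<Rightarrow> (nat \<Rightarrow> real) \<Rightarrow> cl" where
  "pderiv_cl j F y = (\<lambda>A. vector_derivative (\<lambda>t. F (y(j := t)) A) (at (y j)))"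

definition Gamma_op :: "nat \<Rightarrow> ((nat \<Rightarrow> real) \<Rightarrow> cl) \<Rightarrow> ((nat \<Rightarrow> real) \<Rightarrow> cl)" where
  "Gamma_op m F = (\<lambda>y C. - (\<Sum>j\<in>{1..m}. \<Sum>k\<in>{j<..m}.
      cl_mult m (cl_blade {j, k})
        (\<lambda>A. complex_of_real (y j) * pderiv_cl k F y A
             - complex_of_real (y k) * pderiv_cl j F y A) C))"

definition exp_Gamma_term :: "nat \<Rightarrow> ((nat \<Rightarrow> real) \<Rightarrow> cl) \<Rightarrow> (nat \<Rightarrow> real) \<Rightarrow> nat \<Rightarrow> cl" where
  "exp_Gamma_term m F y n = cl_smult ((\<i> * complex_of_real pi / 2) ^ n / fact n) ((Gamma_op m ^^ n) F y)"

definition bessel_J :: "nat \<Rightarrow> real \<Rightarrow> real" where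
  "bessel_J n z = (\<Sum>k. (-1) ^ k / (fact k * fact (k + n)) * (z / 2) ^ (2 * k + n))"

end

theory Submission
  imports Defs
begin

text \<open>
  Write \<open>p = (x, y)\<close>, \<open>\<rho> = |x|\<^sup>2 |y|\<^sup>2\<close>, \<open>W = x \<and> y\<close> and \<open>l = m/2 - 1\<close>. Since \<open>\<Gamma> p = W\<close>, \<open>\<Gamma> \<rho> = 0\<close> and \<open>W\<^sup>2 = p\<^sup>2 - \<rho>\<close>,
  the operator acts on functions \<open>a(p, \<rho>) + W b(p, \<rho>)\<close> by
  \<open>(a, b) \<mapsto> ((m - 1) p b + (p\<^sup>2 - \<rho>) b\<^sub>p, a\<^sub>p + (m - 2) b)\<close>. Substituting
  \<open>a = e\<^sup>t\<^sup>l (s\<^sub>t - l s)\<close>, \<open>b = e\<^sup>t\<^sup>l s\<^sub>p\<close> turns the flow \<open>e\<^sup>t\<^sup>\<Gamma>\<close> into the wave equation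
  \<open>s\<^sub>t\<^sub>t = (l\<^sup>2 - \<Delta>) s\<close> on the sphere, whose solution with \<open>s = 0\<close>, \<open>s\<^sub>t = e\<^sup>-\<^sup>i\<^sup>p\<close> at \<open>t = 0\<close> has as coefficient
  of \<open>p\<^sup>n \<rho>\<^sup>L\<close> an explicit finite combination of the exponentials \<open>e\<^sup>\<plusminus>\<^sup>t\<^sup>v\<close> with \<open>v = n + l + 2 q\<close>, \<open>q \<le> L\<close>.
  The \<open>N\<close>-th Taylor coefficients in \<open>t\<close> are the coefficients of \<open>\<Gamma>\<^sup>N e\<^sup>-\<^sup>i\<^sup>p\<close>, and they grow slowly enough for
  all sums to be interchanged. At \<open>t = i \<pi>/2\<close> the sum over \<open>q\<close> becomes the Beta integral
  \<open>\<integral> u\<^sup>n\<^sup>+\<^sup>l\<^sup>-\<^sup>1 (1 - u\<^sup>2)\<^sup>L du\<close>, and summing over \<open>n\<close> and \<open>L\<close> under the integral yields \<open>e\<^sup>\<plusminus>\<^sup>p\<^sup>u\<close> and the Bessel functions.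
\<close>

section \<open>The Clifford algebra\<close>

definition flip :: "nat \<Rightarrow> nat set \<Rightarrow> nat set" where
  "flip j C = (C - {j}) \<union> ({j} - C)"

text \<open>The sign in \<open>e_j e_B\<close>: moving \<open>e_j\<close> into place costs one sign
  per smaller index of B, and an index equal to j contributes \<open>e_j^2 = -1\<close>; hence the
  count uses \<open>b \<le> j\<close> rather than \<open>b < j\<close>.\<close>

definition blade_eps :: "nat \<Rightarrow> nat set \<Rightarrow> complex" where
  "blade_eps j B = (-1) ^ card {b \<in> B. b \<le> j}"

text \<open>Left multiplication by \<open>e\<^sub>j\<close>: the coefficient at \<open>C\<close> comes from the blade \<open>B\<close> with \<open>{j} \<triangle> B = C\<close>.\<close>

definition cl_gen :: "nat \<Rightarrow> cl \<Rightarrow> cl" where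
  "cl_gen j u = (\<lambda>C. blade_eps j (flip j C) * u (flip j C))"

lemma flip_flip [simp]: "flip j (flip j C) = C"
  by (auto simp: flip_def)

lemma flip_commute: "flip j (flip k C) = flip k (flip j C)"
  by (auto simp: flip_def)

text \<open>Toggling k changes the counted set by the element k exactly when k \<le> j. The case k =
  j yields \<open>e_j^2 = -1\<close>; for distinct j and k exactly one of k \<le> j and j \<le> k
  holds, which is anticommutation.\<close>

lemma blade_eps_flip: "blade_eps j (flip k B) = (if k \<le> j then - blade_eps j B else blade_eps j B)"
proof (cases "k \<le> j")
  case False
  then have "{b \<in> flip k B. b \<le> j} = {b \<in> B. b \<le> j}" by (auto simp: flip_def)
  with False show ?thesis by (simp add: blade_eps_def)
next
  case True
  have fin: "finite {b \<in> B. b \<le> j}" "finite {b \<in> flip k B. b \<le> j}" by auto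
  show ?thesis
  proof (cases "k \<in> B")
    case kB: True
    have "{b \<in> B. b \<le> j} = insert k {b \<in> flip k B. b \<le> j}" "k \<notin> {b \<in> flip k B. b \<le> j}"
      using True kB by (auto simp: flip_def)
    then have "card {b \<in> B. b \<le> j} = Suc (card {b \<in> flip k B. b \<le> j})"
      using fin by (metis card_insert_disjoint)
    with True show ?thesis by (simp add: blade_eps_def)
  next
    case kB: False
    have "{b \<in> flip k B. b \<le> j} = insert k {b \<in> B. b \<le> j}" "k \<notin> {b \<in> B. b \<le> j}"
      using True kB by (auto simp: flip_def)
    then have "card {b \<in> flip k B. b \<le> j} = Suc (card {b \<in> B. b \<le> j})"
      using fin by (metis card_insert_disjoint)
    with True show ?thesis by (simp add: blade_eps_def)
  qed
qed

lemma blade_eps_square [simp]: "blade_eps j B * blade_eps j B = 1"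
  by (simp add: blade_eps_def flip: power_mult_distrib)

lemma cl_gen_square: "cl_gen j (cl_gen j u) = (\<lambda>C. - u C)"
  by (auto simp: cl_gen_def blade_eps_flip mult.assoc[symmetric])

lemma cl_gen_anticommute:
  assumes "j \<noteq> k"
  shows "cl_gen j (cl_gen k u) C = - cl_gen k (cl_gen j u) C"
  using assms by (cases "j < k") (auto simp: cl_gen_def blade_eps_flip flip_commute[of j k])

lemma cl_gen_sum: "cl_gen j (\<lambda>A. \<Sum>i\<in>I. c i * u i A) = (\<lambda>A. \<Sum>i\<in>I. c i * cl_gen j (u i) A)"
  by (simp add: cl_gen_def sum_distrib_left mult.left_commute)

lemma cl_gen_add: "cl_gen j (\<lambda>A. u A + v A) = (\<lambda>A. cl_gen j u A + cl_gen j v A)"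
  by (simp add: cl_gen_def algebra_simps)

lemma cl_gen_smult: "cl_gen j (\<lambda>A. c * u A) = (\<lambda>A. c * cl_gen j u A)"
  by (simp add: cl_gen_def algebra_simps)

text \<open>\<open>cl_mult\<close> sums over blades inside \<open>{1..m}\<close> only, whereas
  \<open>cl_gen\<close> acts on every coefficient function; on elements with this support the two
  descriptions can be compared.\<close>

definition cl_supp :: "nat \<Rightarrow> cl \<Rightarrow> bool" where
  "cl_supp m u \<longleftrightarrow> (\<forall>A. \<not> A \<subseteq> {1..m} \<longrightarrow> u A = 0)"

section \<open>Products with the basis bivectors\<close>

lemma blade_sign_pair:
  assumes "j < k" "finite B"
  shows "blade_sign {j, k} B = blade_eps j B * blade_eps k B"
proof -
  have "{(a, b). a \<in> {j, k} \<and> b \<in> B \<and> b < a} =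
        Pair j ` {b \<in> B. b < j} \<union> Pair k ` {b \<in> B. b < k}" by auto
  moreover have "card \<dots> = card (Pair j ` {b \<in> B. b < j}) + card (Pair k ` {b \<in> B. b < k})"
    using assms by (intro card_Un_disjoint) auto
  ultimately have 1: "card {(a, b). a \<in> {j, k} \<and> b \<in> B \<and> b < a} =
      card {b \<in> B. b < j} + card {b \<in> B. b < k}"
    by (simp add: card_image inj_on_def)
  have 2: "card ({j, k} \<inter> B) = card ({j} \<inter> B) + card ({k} \<inter> B)"
    using assms by (subst card_Un_disjoint[symmetric]) (auto intro: arg_cong[where f = card])
  have 3: "card {b \<in> B. b \<le> i} = card {b \<in> B. b < i} + card ({i} \<inter> B)" for i
    using assms by (subst card_Un_disjoint[symmetric]) (auto intro: arg_cong[where f = card])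
  show ?thesis
    unfolding blade_sign_def blade_eps_def 1 2 3 by (simp add: power_add)
qed

text \<open>Trades the double sum over blades for two generator steps, for which the Clifford
  relations are available as operator identities.\<close>

lemma cl_mult_pair:
  assumes "j < k" "j \<in> {1..m}" "k \<in> {1..m}" "cl_supp m u"
  shows "cl_mult m (cl_blade {j, k}) u C = cl_gen j (cl_gen k u) C"
proof -
  let ?D = "{j, k}" and ?B = "flip k (flip j C)"
  have D: "?D \<in> Pow {1..m}" using assms by auto
  have B: "(?D - B) \<union> (B - ?D) = C \<longleftrightarrow> B = ?B" for B
    using assms(1) by (auto simp: flip_def)
  have "cl_mult m (cl_blade ?D) u C = (\<Sum>A\<in>Pow {1..m}. if A = ?D then
      \<Sum>B\<in>Pow {1..m}. if (?D - B) \<union> (B - ?D) = C then blade_sign ?D B * u B else 0 else 0)"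
    unfolding cl_mult_def cl_blade_def by (intro sum.cong refl) (simp cong: if_cong)
  also have "\<dots> = (\<Sum>B\<in>Pow {1..m}. if B = ?B then blade_sign ?D B * u B else 0)"
    using D by (simp add: B)
  also have "\<dots> = (if ?B \<in> Pow {1..m} then blade_sign ?D ?B * u ?B else 0)"
    by (simp only: sum.delta finite_Pow_iff finite_atLeastAtMost)
  also have "\<dots> = (if ?B \<in> Pow {1..m} then blade_eps j ?B * blade_eps k ?B * u ?B else 0)"
    using assms(1) finite_subset[of ?B "{1..m}"] by (auto simp: blade_sign_pair)
  also have "\<dots> = blade_eps j ?B * blade_eps k ?B * u ?B"
    using assms(4) by (auto simp: cl_supp_def)
  \<comment> \<open>In \<open>cl_gen j (cl_gen k u)\<close> the sign of \<open>e_j\<close> is read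
    off at \<open>flip j C\<close>, which is \<open>flip k ?B\<close>; as j < k, toggling k does not
    alter it.\<close>
  also have "\<dots> = cl_gen j (cl_gen k u) C"
    using assms(1) by (simp add: cl_gen_def blade_eps_flip)
  finally show ?thesis .
qed

section \<open>Left multiplication by vectors, and the wedge product\<close>

definition cl_vec :: "nat \<Rightarrow> (nat \<Rightarrow> real) \<Rightarrow> cl \<Rightarrow> cl" where
  "cl_vec m x u = (\<lambda>C. \<Sum>j\<in>{1..m}. complex_of_real (x j) * cl_gen j u C)"

abbreviation cl_one :: cl where "cl_one \<equiv> cl_scalar 1"

text \<open>Anticommutation brings the sums over j < k in the wedge and in Gamma to the form
  \<open>f j k + f k j\<close>. Full double sums then factor into multiplications by vectors, at the
  price of a diagonal correction.\<close>

lemma sum_offdiag: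
  fixes f :: "nat \<Rightarrow> nat \<Rightarrow> 'a::ab_group_add"
  shows "(\<Sum>j\<in>{1..m}. \<Sum>k\<in>{j<..m}. f j k + f k j) =
         (\<Sum>j\<in>{1..m}. \<Sum>k\<in>{1..m}. f j k) - (\<Sum>j\<in>{1..m}. f j j)"
proof (induction m)
  case 0
  then show ?case by simp
next
  case (Suc m)
  have *: "{j<..Suc m} = insert (Suc m) {j<..m}" if "j \<in> {1..m}" for j
    using that by auto
  have "(\<Sum>j\<in>{1..Suc m}. \<Sum>k\<in>{j<..Suc m}. f j k + f k j) =
        (\<Sum>j\<in>{1..m}. \<Sum>k\<in>{j<..Suc m}. f j k + f k j)" by simp
  also have "\<dots> = (\<Sum>j\<in>{1..m}. (f j (Suc m) + f (Suc m) j) + (\<Sum>k\<in>{j<..m}. f j k + f k j))"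
    by (intro sum.cong refl) (simp add: *)
  also have "\<dots> = (\<Sum>j\<in>{1..m}. f j (Suc m) + f (Suc m) j) +
      ((\<Sum>j\<in>{1..m}. \<Sum>k\<in>{1..m}. f j k) - (\<Sum>j\<in>{1..m}. f j j))"
    by (simp only: sum.distrib[of "\<lambda>j. f j (Suc m) + f (Suc m) j"] Suc.IH)
  finally show ?case by (simp add: sum.distrib)
qed


lemma cl_gen_vec:
  assumes "k \<in> {1..m}"
  shows "cl_gen k (cl_vec m x u) C = - cl_vec m x (cl_gen k u) C - 2 * complex_of_real (x k) * u C"
proof -
  have "cl_gen k (cl_vec m x u) C =
      (\<Sum>j\<in>{1..m}. complex_of_real (x j) * cl_gen k (cl_gen j u) C)"
    by (simp add: cl_vec_def cl_gen_sum)
  also have "\<dots> = (\<Sum>j\<in>{1..m}. - (complex_of_real (x j) * cl_gen j (cl_gen k u) C)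
      - (if j = k then 2 * complex_of_real (x k) * u C else 0))"
    by (intro sum.cong) (auto simp: cl_gen_square cl_gen_anticommute[of k])
  also have "\<dots> = - cl_vec m x (cl_gen k u) C - 2 * complex_of_real (x k) * u C"
    using assms by (simp add: sum_subtractf sum_negf cl_vec_def)
  finally show ?thesis .
qed

lemma cl_vec_anticommute:
  "cl_vec m x (cl_vec m y u) C = - cl_vec m y (cl_vec m x u) C - 2 * complex_of_real (vinner m x y) * u C"
proof -
  have "cl_vec m x (cl_vec m y u) C =
      (\<Sum>j\<in>{1..m}. complex_of_real (x j) * (- cl_vec m y (cl_gen j u) C - 2 * complex_of_real (y j) * u C))"
    unfolding cl_vec_def[of m x] by (intro sum.cong) (auto simp: cl_gen_vec)
  also have "\<dots> = - (\<Sum>j\<in>{1..m}. complex_of_real (x j) * cl_vec m y (cl_gen j u) C)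
      - 2 * complex_of_real (vinner m x y) * u C"
    by (simp add: algebra_simps sum_subtractf sum_negf vinner_def sum_distrib_left sum_distrib_right)
  also have "(\<Sum>j\<in>{1..m}. complex_of_real (x j) * cl_vec m y (cl_gen j u) C) = cl_vec m y (cl_vec m x u) C"
  proof -
    have "cl_vec m y (cl_vec m x u) C = (\<Sum>k\<in>{1..m}. \<Sum>j\<in>{1..m}.
        complex_of_real (y k) * (complex_of_real (x j) * cl_gen k (cl_gen j u) C))"
      unfolding cl_vec_def by (simp add: cl_gen_sum sum_distrib_left)
    also have "\<dots> = (\<Sum>j\<in>{1..m}. \<Sum>k\<in>{1..m}.
        complex_of_real (y k) * (complex_of_real (x j) * cl_gen k (cl_gen j u) C))"
      by (rule sum.swap)
    finally show ?thesis
      unfolding cl_vec_def by (simp add: sum_distrib_left mult.left_commute)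
  qed
  finally show ?thesis .
qed

lemma cl_vec_square: "cl_vec m x (cl_vec m x u) C = - complex_of_real (vinner m x x) * u C"
proof -
  let ?a = "cl_vec m x (cl_vec m x u) C"
  have "?a + ?a = ?a + (- ?a - 2 * complex_of_real (vinner m x x) * u C)"
    using cl_vec_anticommute[of m x x u C] by (rule arg_cong)
  also have "\<dots> = 2 * (- complex_of_real (vinner m x x) * u C)" by simp
  finally have "2 * ?a = 2 * (- complex_of_real (vinner m x x) * u C)" by (simp only: mult_2)
  then show ?thesis by (simp only: mult_cancel_left) simp
qed

lemma cl_vec_add: "cl_vec m x (\<lambda>A. u A + v A) C = cl_vec m x u C + cl_vec m x v C"
  by (simp add: cl_vec_def cl_gen_add algebra_simps sum.distrib)

lemma cl_vec_smult: "cl_vec m x (\<lambda>A. c * u A) C = c * cl_vec m x u C"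
  by (simp add: cl_vec_def cl_gen_smult sum_distrib_left mult.left_commute)

lemma cl_vec_uminus: "cl_vec m x (\<lambda>A. - u A) C = - cl_vec m x u C"
  using cl_vec_smult[of m x "-1" u C] by simp

text \<open>In the product x y the off-diagonal terms pair up to the bivector and the diagonal gives
  -(x, y). Multiplication by W is therefore x y + (x, y), and identities for W reduce to vector
  anticommutation.\<close>

lemma cl_bivector_eq:
  "(\<Sum>j\<in>{1..m}. \<Sum>k\<in>{j<..m}. complex_of_real (x j * y k - x k * y j) * cl_gen j (cl_gen k u) C)
   = cl_vec m x (cl_vec m y u) C + complex_of_real (vinner m x y) * u C"
proof -
  define f where "f j k = complex_of_real (x j * y k) * cl_gen j (cl_gen k u) C" for j k
  have "(\<Sum>j\<in>{1..m}. \<Sum>k\<in>{j<..m}. complex_of_real (x j * y k - x k * y j) * cl_gen j (cl_gen k u) C)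
      = (\<Sum>j\<in>{1..m}. \<Sum>k\<in>{j<..m}. f j k + f k j)"
  proof (intro sum.cong refl)
    fix j k assume "k \<in> {j<..m}"
    then have "cl_gen k (cl_gen j u) C = - cl_gen j (cl_gen k u) C"
      by (intro cl_gen_anticommute) auto
    then show "complex_of_real (x j * y k - x k * y j) * cl_gen j (cl_gen k u) C = f j k + f k j"
      by (simp add: f_def algebra_simps)
  qed
  also have "\<dots> = (\<Sum>j\<in>{1..m}. \<Sum>k\<in>{1..m}. f j k) - (\<Sum>j\<in>{1..m}. f j j)"
    by (rule sum_offdiag)
  also have "(\<Sum>j\<in>{1..m}. \<Sum>k\<in>{1..m}. f j k) = cl_vec m x (cl_vec m y u) C"
    unfolding cl_vec_def f_def by (simp add: cl_gen_sum sum_distrib_left mult.assoc)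
  also have "(\<Sum>j\<in>{1..m}. f j j) = - complex_of_real (vinner m x y) * u C"
    by (simp add: f_def cl_gen_square vinner_def sum_negf sum_distrib_right)
  finally show ?thesis by simp
qed

lemma cl_supp_one: "cl_supp m cl_one"
  by (auto simp: cl_supp_def cl_scalar_def)

lemma cl_gen_gen_one:
  assumes "j < k"
  shows "cl_gen j (cl_gen k cl_one) C = cl_blade {j, k} C"
proof -
  have "flip k (flip j C) = {} \<longleftrightarrow> C = {j, k}"
    using assms by (auto simp: flip_def)
  moreover have "blade_eps i {} = 1" for i by (simp add: blade_eps_def)
  ultimately show ?thesis
    using assms blade_eps_flip[of j k "flip k (flip j C)"]
    by (auto simp: cl_gen_def cl_scalar_def cl_blade_def)
qed

lemma cl_wedge_eq:
  "cl_wedge m x y C = cl_vec m x (cl_vec m y cl_one) C + complex_of_real (vinner m x y) * cl_one C"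
proof -
  have "cl_wedge m x y C = (\<Sum>j\<in>{1..m}. \<Sum>k\<in>{j<..m}.
      complex_of_real (x j * y k - x k * y j) * cl_gen j (cl_gen k cl_one) C)"
    unfolding cl_wedge_def by (intro sum.cong refl) (auto simp: cl_gen_gen_one)
  then show ?thesis by (simp only: cl_bivector_eq)
qed

lemma cl_supp_wedge: "cl_supp m (cl_wedge m x y)"
  unfolding cl_supp_def cl_wedge_def cl_blade_def
proof (intro allI impI sum.neutral ballI)
  fix A j k
  assume "\<not> A \<subseteq> {1..m}" "j \<in> {1..m}" "k \<in> {j<..m}"
  then show "complex_of_real (x j * y k - x k * y j) * (if A = {j, k} then 1 else 0) = 0"
    by auto
qed

text \<open>This is W^2 = p^2 - |x|^2 |y|^2. With W = x y + p, anticommutation gives y W = |y|^2 x -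
  p y; multiplying by x and adding p W cancels the x y terms.\<close>

lemma cl_wedge_square:
  "(\<Sum>j\<in>{1..m}. \<Sum>k\<in>{j<..m}. complex_of_real (x j * y k - x k * y j) *
      cl_gen j (cl_gen k (cl_wedge m x y)) C)
   = complex_of_real ((vinner m x y)\<^sup>2 - vinner m x x * vinner m y y) * cl_one C"
proof -
  let ?p = "complex_of_real (vinner m x y)" and ?X = "cl_vec m x" and ?Y = "cl_vec m y"
  have W: "cl_wedge m x y = (\<lambda>C. ?X (?Y cl_one) C + ?p * cl_one C)"
    by (simp add: cl_wedge_eq fun_eq_iff)
  have Y: "?Y (cl_wedge m x y) = (\<lambda>C. complex_of_real (vinner m y y) * ?X cl_one C - ?p * ?Y cl_one C)"
  proof
    fix C
    have "?Y (cl_wedge m x y) C = ?Y (?X (?Y cl_one)) C + ?p * ?Y cl_one C"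
      unfolding W by (simp only: cl_vec_add cl_vec_smult)
    also have "?Y (?X (?Y cl_one)) C = - ?X (?Y (?Y cl_one)) C - 2 * ?p * ?Y cl_one C"
      using cl_vec_anticommute[of m y x] by (simp add: vinner_def mult.commute)
    also have "?Y (?Y cl_one) = (\<lambda>C. - complex_of_real (vinner m y y) * cl_one C)"
      by (simp only: cl_vec_square fun_eq_iff simp_thms)
    finally show "?Y (cl_wedge m x y) C = complex_of_real (vinner m y y) * ?X cl_one C - ?p * ?Y cl_one C"
      by (simp only: cl_vec_smult) (simp add: algebra_simps)
  qed
  have "?X (?Y (cl_wedge m x y)) C = complex_of_real (vinner m y y) * ?X (?X cl_one) C - ?p * ?X (?Y cl_one) C"
    unfolding Y using cl_vec_add[of m x "\<lambda>C. complex_of_real (vinner m y y) * ?X cl_one C" "\<lambda>C. - (?p * ?Y cl_one C)" C]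
    by (simp add: cl_vec_smult cl_vec_uminus)
  then show ?thesis
    unfolding cl_bivector_eq by (simp add: W cl_vec_square algebra_simps power2_eq_square)
qed

section \<open>The Gamma operator on functions a + W b\<close>

definition unit_vec :: "nat \<Rightarrow> nat \<Rightarrow> real" where
  "unit_vec k = (\<lambda>i. if i = k then 1 else 0)"

lemma cl_vec_unit: "k \<in> {1..m} \<Longrightarrow> cl_vec m (unit_vec k) u = cl_gen k u"
  unfolding cl_vec_def unit_vec_def by (simp add: fun_eq_iff if_distrib[of of_real] if_distrib[of "\<lambda>z. z * _"] cong: if_cong)

lemma cl_wedge_unit:
  assumes "k \<in> {1..m}"
  shows "cl_wedge m x (unit_vec k) C = cl_vec m x (cl_gen k cl_one) C + complex_of_real (x k) * cl_one C"
proof -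
  have "vinner m x (unit_vec k) = x k"
    using assms by (simp add: vinner_def unit_vec_def if_distrib[of "\<lambda>z. _ * z"] cong: if_cong)
  then show ?thesis using assms by (simp add: cl_wedge_eq cl_vec_unit)
qed

lemma cl_wedge_linear:
  "cl_wedge m x (\<lambda>i. y i + s * z i) A = cl_wedge m x y A + complex_of_real s * cl_wedge m x z A"
  unfolding cl_wedge_def sum_distrib_left sum.distrib[symmetric]
  by (intro sum.cong refl) (simp add: algebra_simps)

lemma cl_wedge_sum_unit:
  "cl_wedge m x y A = (\<Sum>k\<in>{1..m}. complex_of_real (y k) * cl_wedge m x (unit_vec k) A)"
proof -
  have "(\<Sum>k\<in>{1..m}. complex_of_real (y k) * cl_wedge m x (unit_vec k) A) =
    (\<Sum>k\<in>{1..m}. complex_of_real (y k) * cl_vec m x (cl_gen k cl_one) A) + complex_of_real (vinner m x y) * cl_one A"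
    by (simp add: cl_wedge_unit distrib_left sum.distrib vinner_def sum_distrib_right mult.left_commute mult.assoc)
  also have "(\<Sum>k\<in>{1..m}. complex_of_real (y k) * cl_vec m x (cl_gen k cl_one) A) = cl_vec m x (cl_vec m y cl_one) A"
    unfolding cl_vec_def cl_gen_sum sum_distrib_left
    by (subst sum.swap) (simp add: ac_simps)
  finally show ?thesis by (simp add: cl_wedge_eq)
qed

text \<open>The left side is minus Gamma applied to W, since the wedge of x and e_k is the k-th
  partial derivative of W. Multiplying that derivative by e_k gives x - x_k e_k, so the sum over k
  is (m - 1) x. Multiplying by y yields (m - 1) (-W - p), and the diagonal to be subtracted is
  -W.\<close>

lemma Gamma_wedge:
  "(\<Sum>j\<in>{1..m}. \<Sum>k\<in>{j<..m}. complex_of_real (y j) * cl_gen j (cl_gen k (cl_wedge m x (unit_vec k))) C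
      - complex_of_real (y k) * cl_gen j (cl_gen k (cl_wedge m x (unit_vec j))) C)
   = - (of_nat m - 1) * complex_of_real (vinner m x y) * cl_one C - (of_nat m - 2) * cl_wedge m x y C"
proof -
  let ?V = "\<lambda>k. cl_wedge m x (unit_vec k)" and ?X = "cl_vec m x" and ?Y = "cl_vec m y"
    and ?p = "complex_of_real (vinner m x y)"
  define f where "f j k = complex_of_real (y j) * cl_gen j (cl_gen k (?V k)) C" for j k
  have V: "(\<Sum>k\<in>{1..m}. cl_gen k (?V k) A) = (of_nat m - 1) * ?X cl_one A" for A
  proof -
    have "cl_gen k (?V k) A = ?X cl_one A - complex_of_real (x k) * cl_gen k cl_one A" if k: "k \<in> {1..m}" for k
    proof -
      have "?V k = (\<lambda>A. ?X (cl_gen k cl_one) A + complex_of_real (x k) * cl_one A)"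
        using k by (simp add: cl_wedge_unit fun_eq_iff)
      then have "cl_gen k (?V k) A = cl_gen k (?X (cl_gen k cl_one)) A + complex_of_real (x k) * cl_gen k cl_one A"
        by (simp only: cl_gen_add cl_gen_smult)
      also have "\<dots> = ?X cl_one A - complex_of_real (x k) * cl_gen k cl_one A"
        using k by (simp add: cl_gen_vec cl_gen_square cl_vec_uminus)
      finally show ?thesis .
    qed
    then have "(\<Sum>k\<in>{1..m}. cl_gen k (?V k) A) = (\<Sum>k\<in>{1..m}. ?X cl_one A - complex_of_real (x k) * cl_gen k cl_one A)"
      by (intro sum.cong) auto
    also have "\<dots> = (of_nat m - 1) * ?X cl_one A"
      by (simp add: sum_subtractf left_diff_distrib cl_vec_def)
    finally show ?thesis .
  qed
  have "(\<Sum>j\<in>{1..m}. \<Sum>k\<in>{j<..m}. complex_of_real (y j) * cl_gen j (cl_gen k (?V k)) C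
      - complex_of_real (y k) * cl_gen j (cl_gen k (?V j)) C)
      = (\<Sum>j\<in>{1..m}. \<Sum>k\<in>{j<..m}. f j k + f k j)"
  proof (intro sum.cong refl)
    fix j k assume "k \<in> {j<..m}"
    then have "cl_gen k (cl_gen j (?V j)) C = - cl_gen j (cl_gen k (?V j)) C"
      by (intro cl_gen_anticommute) auto
    then show "complex_of_real (y j) * cl_gen j (cl_gen k (?V k)) C
        - complex_of_real (y k) * cl_gen j (cl_gen k (?V j)) C = f j k + f k j"
      by (simp add: f_def)
  qed
  also have "\<dots> = (\<Sum>j\<in>{1..m}. \<Sum>k\<in>{1..m}. f j k) - (\<Sum>j\<in>{1..m}. f j j)"
    by (rule sum_offdiag)
  also have "(\<Sum>j\<in>{1..m}. \<Sum>k\<in>{1..m}. f j k) = (of_nat m - 1) * ?Y (?X cl_one) C"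
  proof -
    have "(\<Sum>j\<in>{1..m}. \<Sum>k\<in>{1..m}. f j k) =
        (\<Sum>j\<in>{1..m}. complex_of_real (y j) * cl_gen j (\<lambda>A. \<Sum>k\<in>{1..m}. cl_gen k (?V k) A) C)"
      using cl_gen_sum[where I = "{1..m}" and c = "\<lambda>_. 1"] by (simp add: f_def sum_distrib_left)
    then show ?thesis
      unfolding V cl_gen_smult cl_vec_def[of m y] sum_distrib_left by (simp add: mult.left_commute)
  qed
  also have "?Y (?X cl_one) C = - cl_wedge m x y C - ?p * cl_one C"
    using cl_vec_anticommute[of m x y cl_one C] by (simp add: cl_wedge_eq)
  also have "(\<Sum>j\<in>{1..m}. f j j) = - cl_wedge m x y C"
    by (simp add: f_def cl_gen_square sum_negf cl_wedge_sum_unit[of m x y])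
  finally show ?thesis by (simp add: algebra_simps)
qed

text \<open>The gradients split into a part along x and a part along y. The rotation fields y_j d_k
  - y_k d_j annihilate the part along y, so \<open>a2\<close> and \<open>b2\<close> cancel, and turn
  the part along x into components of W. What remains is \<open>a1\<close> W + \<open>b1\<close> W^2
  + b Gamma(W).\<close>

lemma Gamma_op_zonal:
  fixes a b :: "(nat \<Rightarrow> real) \<Rightarrow> complex"
  assumes a: "\<And>k. k \<in> {1..m} \<Longrightarrow> ((\<lambda>t. a (y(k := t))) has_vector_derivative
                 complex_of_real (x k) * a1 + complex_of_real (y k) * a2) (at (y k))"
  assumes b: "\<And>k. k \<in> {1..m} \<Longrightarrow> ((\<lambda>t. b (y(k := t))) has_vector_derivative
                 complex_of_real (x k) * b1 + complex_of_real (y k) * b2) (at (y k))"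
  shows "Gamma_op m (\<lambda>z. cl_add (cl_scalar (a z)) (cl_smult (b z) (cl_wedge m x z))) y =
    cl_add (cl_scalar ((of_nat m - 1) * complex_of_real (vinner m x y) * b y
             + complex_of_real ((vinner m x y)\<^sup>2 - vinner m x x * vinner m y y) * b1))
      (cl_smult (a1 + (of_nat m - 2) * b y) (cl_wedge m x y))"
proof
  fix C
  define F where "F = (\<lambda>z. cl_add (cl_scalar (a z)) (cl_smult (b z) (cl_wedge m x z)))"
  let ?W = "cl_wedge m x y" and ?V = "\<lambda>k. cl_wedge m x (unit_vec k)"
  define w where "w j k = complex_of_real (x j * y k - x k * y j)" for j k
  have D: "pderiv_cl k F y A = (complex_of_real (x k) * a1 + complex_of_real (y k) * a2) * cl_one A
      + (complex_of_real (x k) * b1 + complex_of_real (y k) * b2) * ?W A + b y * ?V k A"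
    if k: "k \<in> {1..m}" for k A
  proof -
    \<comment> \<open>Changing one coordinate is a shift along a unit vector, so the wedge is affine
      in t with slope \<open>?V k\<close>.\<close>
    have upd: "y(k := t) = (\<lambda>i. y i + (t - y k) * unit_vec k i)" for t
      by (auto simp: unit_vec_def)
    have "((\<lambda>t. cl_wedge m x (y(k := t)) A) has_vector_derivative ?V k A) (at (y k))"
      unfolding upd cl_wedge_linear by (auto intro!: derivative_eq_intros)
    then have "((\<lambda>t. a (y(k := t)) * cl_one A + b (y(k := t)) * cl_wedge m x (y(k := t)) A)
        has_vector_derivative (complex_of_real (x k) * a1 + complex_of_real (y k) * a2) * cl_one A
        + (b (y(k := y k)) * ?V k A + (complex_of_real (x k) * b1 + complex_of_real (y k) * b2)
            * cl_wedge m x (y(k := y k)) A)) (at (y k))"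
      by (intro has_vector_derivative_add has_vector_derivative_mult has_vector_derivative_mult_left a b k)
    moreover have "F z A = a z * cl_one A + b z * cl_wedge m x z A" for z
      by (simp add: F_def cl_add_def cl_scalar_def cl_smult_def)
    ultimately show ?thesis
      unfolding pderiv_cl_def by (intro vector_derivative_at) (simp add: algebra_simps)
  qed
  have "cl_mult m (cl_blade {j, k}) (\<lambda>A. complex_of_real (y j) * pderiv_cl k F y A
             - complex_of_real (y k) * pderiv_cl j F y A) C =
        - (a1 * (w j k * cl_gen j (cl_gen k cl_one) C) + b1 * (w j k * cl_gen j (cl_gen k ?W) C))
        + b y * (complex_of_real (y j) * cl_gen j (cl_gen k (?V k)) C - complex_of_real (y k) * cl_gen j (cl_gen k (?V j)) C)"
    if j: "j \<in> {1..m}" and k: "k \<in> {j<..m}" for j k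
  proof -
    have eq: "(\<lambda>A. complex_of_real (y j) * pderiv_cl k F y A - complex_of_real (y k) * pderiv_cl j F y A)
       = (\<lambda>A. ((- a1 * w j k) * cl_one A + (- b1 * w j k) * ?W A) + ((b y * complex_of_real (y j)) * ?V k A +
          (- b y * complex_of_real (y k)) * ?V j A))"
      using j k by (simp add: D w_def fun_eq_iff algebra_simps)
    have "cl_supp m (\<lambda>A. ((- a1 * w j k) * cl_one A + (- b1 * w j k) * ?W A) + ((b y * complex_of_real (y j)) * ?V k A +
          (- b y * complex_of_real (y k)) * ?V j A))"
      using cl_supp_one[of m] cl_supp_wedge[of m x] unfolding cl_supp_def by auto
    then show ?thesis
      unfolding eq using j k
      by (subst cl_mult_pair)
        (simp_all only: cl_gen_add cl_gen_smult, simp_all add: algebra_simps)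
  qed
  then have "Gamma_op m F y C = - (\<Sum>j\<in>{1..m}. \<Sum>k\<in>{j<..m}.
        - (a1 * (w j k * cl_gen j (cl_gen k cl_one) C) + b1 * (w j k * cl_gen j (cl_gen k ?W) C))
        + b y * (complex_of_real (y j) * cl_gen j (cl_gen k (?V k)) C - complex_of_real (y k) * cl_gen j (cl_gen k (?V j)) C))"
    unfolding Gamma_op_def by (simp only: cong: sum.cong)
  also have "\<dots> = a1 * (\<Sum>j\<in>{1..m}. \<Sum>k\<in>{j<..m}. w j k * cl_gen j (cl_gen k cl_one) C)
      + b1 * (\<Sum>j\<in>{1..m}. \<Sum>k\<in>{j<..m}. w j k * cl_gen j (cl_gen k ?W) C)
      - b y * (\<Sum>j\<in>{1..m}. \<Sum>k\<in>{j<..m}. complex_of_real (y j) * cl_gen j (cl_gen k (?V k)) C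
          - complex_of_real (y k) * cl_gen j (cl_gen k (?V j)) C)"
    by (simp only: sum.distrib sum_negf sum_subtractf sum_distrib_left[symmetric]) simp
  also have "\<dots> = a1 * ?W C + b1 * (complex_of_real ((vinner m x y)\<^sup>2 - vinner m x x * vinner m y y) * cl_one C)
      + b y * ((of_nat m - 1) * complex_of_real (vinner m x y) * cl_one C + (of_nat m - 2) * ?W C)"
    unfolding w_def cl_wedge_square Gamma_wedge cl_bivector_eq cl_wedge_eq[symmetric]
    by (simp add: algebra_simps)
  finally show "Gamma_op m F y C = cl_add (cl_scalar ((of_nat m - 1) * complex_of_real (vinner m x y) * b y
             + complex_of_real ((vinner m x y)\<^sup>2 - vinner m x x * vinner m y y) * b1))
      (cl_smult (a1 + (of_nat m - 2) * b y) (cl_wedge m x y)) C"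
    by (cases "C = {}") (simp_all add: cl_add_def cl_smult_def cl_scalar_def algebra_simps)
qed

section \<open>Powers of the Gamma operator on the exponential\<close>

text \<open>The power series in \<open>p\<close> that are the coefficients of \<open>\<rho>\<^sup>L\<close> in \<open>a\<close> and \<open>b\<close>, where \<open>\<Gamma>\<^sup>N e\<^sup>-\<^sup>i\<^sup>p = a + W b\<close>.\<close>

primrec Gamma_fps :: "nat \<Rightarrow> nat \<Rightarrow> nat \<Rightarrow> complex fps \<times> complex fps" where
  "Gamma_fps m 0 L = (if L = 0 then fps_exp (- \<i>) else 0, 0)"
| "Gamma_fps m (Suc N) L =
     (fps_const (of_nat m - 1) * fps_X * snd (Gamma_fps m N L) + fps_X * fps_X * fps_deriv (snd (Gamma_fps m N L))
        - (if L = 0 then 0 else fps_deriv (snd (Gamma_fps m N (L - 1)))),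
      fps_deriv (fst (Gamma_fps m N L)) + fps_const (of_nat m - 2) * snd (Gamma_fps m N L))"

lemma fps_conv_radius_infinity_intros:
  fixes f g :: "complex fps"
  shows "fps_conv_radius f = \<infinity> \<Longrightarrow> fps_conv_radius g = \<infinity> \<Longrightarrow> fps_conv_radius (f + g) = \<infinity>"
    and "fps_conv_radius f = \<infinity> \<Longrightarrow> fps_conv_radius g = \<infinity> \<Longrightarrow> fps_conv_radius (f - g) = \<infinity>"
    and "fps_conv_radius f = \<infinity> \<Longrightarrow> fps_conv_radius g = \<infinity> \<Longrightarrow> fps_conv_radius (f * g) = \<infinity>"
    and "fps_conv_radius f = \<infinity> \<Longrightarrow> fps_conv_radius (fps_deriv f) = \<infinity>"
  using fps_conv_radius_add[of f g] fps_conv_radius_diff[of f g] fps_conv_radius_mult[of f g]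
    fps_conv_radius_deriv[of f]
  by (auto simp: ereal_infty_less_eq)

text \<open>Infinite radius lets \<open>eval_fps\<close> commute with the sums, products and
  derivatives of the recursion at every p.\<close>

lemma Gamma_fps_conv_radius:
  "fps_conv_radius (fst (Gamma_fps m N L)) = \<infinity> \<and> fps_conv_radius (snd (Gamma_fps m N L)) = \<infinity>"
proof (induction N arbitrary: L)
  case 0
  then show ?case by simp
next
  case (Suc N)
  then show ?case by (auto intro!: fps_conv_radius_infinity_intros)
qed

text \<open>Only the term -\<rho> b_p raises the degree in \<rho>, by one per application of Gamma;
  this keeps the sums over L finite.\<close>

lemma Gamma_fps_eq_0: "L > N \<Longrightarrow> Gamma_fps m N L = (0, 0)"
  by (induction N arbitrary: L) auto

lemma vinner_upd:
  assumes "k \<in> {1..m}"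
  shows "vinner m x (y(k := t)) = vinner m x y + (t - y k) * x k"
proof -
  have "vinner m x (y(k := t)) = (\<Sum>j\<in>{1..m}. x j * y j + (if j = k then (t - y k) * x k else 0))"
    unfolding vinner_def by (intro sum.cong) (auto simp: algebra_simps)
  then show ?thesis using assms by (simp add: sum.distrib vinner_def)
qed

lemma vinner_upd2:
  assumes "k \<in> {1..m}"
  shows "vinner m (y(k := t)) (y(k := t)) = vinner m y y + (t\<^sup>2 - (y k)\<^sup>2)"
proof -
  have "vinner m (y(k := t)) (y(k := t)) = (\<Sum>j\<in>{1..m}. y j * y j + (if j = k then t\<^sup>2 - (y k)\<^sup>2 else 0))"
    unfolding vinner_def by (intro sum.cong) (auto simp: power2_eq_square)
  then show ?thesis using assms by (simp add: sum.distrib vinner_def)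
qed

text \<open>As a function of y, p has gradient x and |y|^2 has gradient 2 y, so the chain rule
  delivers the decomposition that \<open>Gamma_op_zonal\<close> requires.\<close>

lemma zonal_has_vector_derivative:
  fixes F :: "nat \<Rightarrow> complex fps" and x y :: "nat \<Rightarrow> real"
  assumes k: "k \<in> {1..m}" and F: "\<And>L. fps_conv_radius (F L) = \<infinity>"
  defines "p \<equiv> complex_of_real (vinner m x y)" and "\<rho> \<equiv> complex_of_real (vinner m x x * vinner m y y)"
  shows "((\<lambda>t. \<Sum>L\<le>N. complex_of_real (vinner m x x * vinner m (y(k := t)) (y(k := t))) ^ L
              * eval_fps (F L) (complex_of_real (vinner m x (y(k := t))))) has_vector_derivative
      complex_of_real (x k) * (\<Sum>L\<le>N. \<rho> ^ L * eval_fps (fps_deriv (F L)) p)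
      + complex_of_real (y k) * (\<Sum>L\<le>N. of_nat L * \<rho> ^ (L - 1) * (2 * complex_of_real (vinner m x x)) * eval_fps (F L) p))
     (at (y k))"
proof -
  define P where "P t = complex_of_real (vinner m x (y(k := t)))" for t
  define R where "R t = complex_of_real (vinner m x x * vinner m (y(k := t)) (y(k := t)))" for t
  have P: "(P has_vector_derivative complex_of_real (x k)) (at (y k))"
    unfolding P_def vinner_upd[OF k] by (auto intro!: derivative_eq_intros)
  have R: "(R has_vector_derivative complex_of_real (vinner m x x * (2 * y k))) (at (y k))"
    unfolding R_def vinner_upd2[OF k]
    by (intro bounded_linear.has_vector_derivative[OF bounded_linear_of_real],
        unfold has_real_derivative_iff_has_vector_derivative[symmetric])
      (auto intro!: derivative_eq_intros)
  have p: "P (y k) = p" and r: "R (y k) = \<rho>" by (simp_all add: P_def R_def p_def \<rho>_def)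
  have E: "((\<lambda>t. eval_fps (F L) (P t)) has_vector_derivative complex_of_real (x k) * eval_fps (fps_deriv (F L)) p) (at (y k))" for L
  proof -
    have "(eval_fps (F L) has_field_derivative eval_fps (fps_deriv (F L)) (P (y k))) (at (P (y k)))"
      by (rule has_field_derivative_eval_fps) (simp add: F)
    from field_vector_diff_chain_at[OF P this] show ?thesis by (simp add: o_def p)
  qed
  have Q: "((\<lambda>t. R t ^ L) has_vector_derivative complex_of_real (vinner m x x * (2 * y k)) * (of_nat L * \<rho> ^ (L - 1))) (at (y k))" for L
  proof -
    have "((\<lambda>z. z ^ L) has_field_derivative of_nat L * R (y k) ^ (L - 1)) (at (R (y k)))"
      by (auto intro!: derivative_eq_intros)
    from field_vector_diff_chain_at[OF R this] show ?thesis by (simp add: o_def r)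
  qed
  have "((\<lambda>t. \<Sum>L\<le>N. R t ^ L * eval_fps (F L) (P t)) has_vector_derivative
     (\<Sum>L\<le>N. R (y k) ^ L * (complex_of_real (x k) * eval_fps (fps_deriv (F L)) p)
        + complex_of_real (vinner m x x * (2 * y k)) * (of_nat L * \<rho> ^ (L - 1)) * eval_fps (F L) (P (y k)))) (at (y k))"
    by (intro has_vector_derivative_sum has_vector_derivative_mult E Q)
  then show ?thesis
    unfolding P_def[symmetric] R_def[symmetric] p r
    by (simp add: sum.distrib sum_distrib_left mult_ac)
qed

lemma Gamma_op_power:
  "(Gamma_op m ^^ N) (\<lambda>z. cl_scalar (exp (- \<i> * complex_of_real (vinner m x z)))) =
   (\<lambda>y. cl_add (cl_scalar (\<Sum>L\<le>N. complex_of_real (vinner m x x * vinner m y y) ^ L *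
              eval_fps (fst (Gamma_fps m N L)) (complex_of_real (vinner m x y))))
      (cl_smult (\<Sum>L\<le>N. complex_of_real (vinner m x x * vinner m y y) ^ L *
              eval_fps (snd (Gamma_fps m N L)) (complex_of_real (vinner m x y))) (cl_wedge m x y)))"
proof (induction N)
  case 0
  show ?case by (simp add: cl_add_def cl_smult_def fun_eq_iff)
next
  case (Suc N)
  let ?A = "\<lambda>L. fst (Gamma_fps m N L)" and ?B = "\<lambda>L. snd (Gamma_fps m N L)"
  have rA: "fps_conv_radius (?A L) = \<infinity>" and rB: "fps_conv_radius (?B L) = \<infinity>" for L
    using Gamma_fps_conv_radius by auto
  note radius = rA rB fps_conv_radius_infinity_intros
  show ?case
  proof
    fix y
    let ?p = "complex_of_real (vinner m x y)" and ?r = "complex_of_real (vinner m x x * vinner m y y)"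
    \<comment> \<open>The coefficients of degree N + 1 in \<rho> vanish, so sums up to N may be read
      as sums up to N + 1, the range belonging to the next power.\<close>
    have B0: "?B (Suc N) = 0" by (simp add: Gamma_fps_eq_0)
    have A0: "?A (Suc N) = 0" by (simp add: Gamma_fps_eq_0)
    have eA: "eval_fps (fst (Gamma_fps m (Suc N) L)) ?p =
        (of_nat m - 1) * ?p * eval_fps (?B L) ?p + ?p\<^sup>2 * eval_fps (fps_deriv (?B L)) ?p
        - (if L = 0 then 0 else eval_fps (fps_deriv (?B (L - 1))) ?p)" for L
      by (simp add: eval_fps_add eval_fps_diff eval_fps_mult radius power2_eq_square)
    have eB: "eval_fps (snd (Gamma_fps m (Suc N) L)) ?p =
        eval_fps (fps_deriv (?A L)) ?p + (of_nat m - 2) * eval_fps (?B L) ?p" for L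
      by (simp add: eval_fps_add eval_fps_mult radius)
    have "(Gamma_op m ^^ Suc N) (\<lambda>z. cl_scalar (exp (- \<i> * complex_of_real (vinner m x z)))) y =
      cl_add (cl_scalar ((of_nat m - 1) * ?p * (\<Sum>L\<le>N. ?r ^ L * eval_fps (?B L) ?p)
             + complex_of_real ((vinner m x y)\<^sup>2 - vinner m x x * vinner m y y) * (\<Sum>L\<le>N. ?r ^ L * eval_fps (fps_deriv (?B L)) ?p)))
      (cl_smult ((\<Sum>L\<le>N. ?r ^ L * eval_fps (fps_deriv (?A L)) ?p) + (of_nat m - 2) * (\<Sum>L\<le>N. ?r ^ L * eval_fps (?B L) ?p)) (cl_wedge m x y))"
      unfolding funpow.simps o_def Suc.IH
      by (rule Gamma_op_zonal[OF zonal_has_vector_derivative zonal_has_vector_derivative]) (auto simp: rA rB)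
    also have "(of_nat m - 1) * ?p * (\<Sum>L\<le>N. ?r ^ L * eval_fps (?B L) ?p)
             + complex_of_real ((vinner m x y)\<^sup>2 - vinner m x x * vinner m y y) * (\<Sum>L\<le>N. ?r ^ L * eval_fps (fps_deriv (?B L)) ?p)
        = (\<Sum>L\<le>Suc N. ?r ^ L * eval_fps (fst (Gamma_fps m (Suc N) L)) ?p)"
    proof -
      have "(\<Sum>L\<le>Suc N. ?r ^ L * eval_fps (fst (Gamma_fps m (Suc N) L)) ?p) =
          (\<Sum>L\<le>Suc N. (of_nat m - 1) * ?p * (?r ^ L * eval_fps (?B L) ?p))
          + (\<Sum>L\<le>Suc N. ?p\<^sup>2 * (?r ^ L * eval_fps (fps_deriv (?B L)) ?p))
          - (\<Sum>L\<le>Suc N. ?r ^ L * (if L = 0 then 0 else eval_fps (fps_deriv (?B (L - 1))) ?p))"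
        unfolding eA by (simp only: sum.distrib[symmetric] sum_subtractf[symmetric]) (simp only: algebra_simps)
      \<comment> \<open>Index shift: multiplication by \<rho> moves the coefficient of degree L - 1
        to degree L.\<close>
      also have "(\<Sum>L\<le>Suc N. ?r ^ L * (if L = 0 then 0 else eval_fps (fps_deriv (?B (L - 1))) ?p))
          = ?r * (\<Sum>L\<le>N. ?r ^ L * eval_fps (fps_deriv (?B L)) ?p)"
        by (subst sum.atMost_Suc_shift) (simp add: sum_distrib_left mult.assoc)
      also have "(\<Sum>L\<le>Suc N. (of_nat m - 1) * ?p * (?r ^ L * eval_fps (?B L) ?p)) =
          (of_nat m - 1) * ?p * (\<Sum>L\<le>N. ?r ^ L * eval_fps (?B L) ?p)"
        by (simp add: B0 sum_distrib_left)
      also have "(\<Sum>L\<le>Suc N. ?p\<^sup>2 * (?r ^ L * eval_fps (fps_deriv (?B L)) ?p)) =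
          ?p\<^sup>2 * (\<Sum>L\<le>N. ?r ^ L * eval_fps (fps_deriv (?B L)) ?p)"
        by (simp add: B0 sum_distrib_left)
      finally show ?thesis by (simp add: algebra_simps)
    qed
    also have "(\<Sum>L\<le>N. ?r ^ L * eval_fps (fps_deriv (?A L)) ?p) + (of_nat m - 2) * (\<Sum>L\<le>N. ?r ^ L * eval_fps (?B L) ?p)
       = (\<Sum>L\<le>Suc N. ?r ^ L * eval_fps (snd (Gamma_fps m (Suc N) L)) ?p)"
      unfolding eB by (simp add: A0 B0 sum_distrib_left sum.distrib distrib_left mult.left_commute)
    finally show "(Gamma_op m ^^ Suc N) (\<lambda>z. cl_scalar (exp (- \<i> * complex_of_real (vinner m x z)))) y =
      cl_add (cl_scalar (\<Sum>L\<le>Suc N. ?r ^ L * eval_fps (fst (Gamma_fps m (Suc N) L)) ?p))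
        (cl_smult (\<Sum>L\<le>Suc N. ?r ^ L * eval_fps (snd (Gamma_fps m (Suc N) L)) ?p) (cl_wedge m x y))" .
  qed
qed

section \<open>Taylor coefficients of the powers\<close>

text \<open>Since B(a, L + 1) = L! / \<open>pochhammer a (Suc L)\<close>, this is
  \<open>L choose q\<close> times the Beta value B(n + q + l, L + 1), divided by 4^L n! (L!)^2.
  Through it the integral over u enters.\<close>

definition zonal_wt :: "real \<Rightarrow> nat \<Rightarrow> nat \<Rightarrow> nat \<Rightarrow> real" where
  "zonal_wt l L n q = of_nat (L choose q) / (4 ^ L * fact n * fact L * pochhammer (real n + real q + l) (Suc L))"

text \<open>The coefficient of p^n \<rho>^L in s is (-i)^n times a signed weighted sum of sinh(t v)
  over these frequencies v. Hence a = e^(t l) (s_t - l s) carries the exponents l + v and l - v with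
  factors (v - l)/2 and (v + l)/2, while b = e^(t l) s_p replaces n by n + 1 and brings down a
  factor n + 1.\<close>

definition zonal_freq :: "real \<Rightarrow> nat \<Rightarrow> nat \<Rightarrow> real" where
  "zonal_freq l n q = real n + l + 2 * real q"

text \<open>The \<open>N\<close>-th derivatives at \<open>t = 0\<close> of the coefficients of \<open>p\<^sup>n \<rho>\<^sup>L\<close> in \<open>a\<close> and \<open>b\<close>, where \<open>e\<^sup>t\<^sup>\<Gamma> e\<^sup>-\<^sup>i\<^sup>p = a + W b\<close>.\<close>

definition zonal_a :: "real \<Rightarrow> nat \<Rightarrow> nat \<Rightarrow> nat \<Rightarrow> complex" where
  "zonal_a l N L n = (- \<i>) ^ n * complex_of_real (\<Sum>q\<le>L. (-1) ^ (L + q) * zonal_wt l L n q / 2 *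
      ((zonal_freq l n q - l) * (l + zonal_freq l n q) ^ N + (zonal_freq l n q + l) * (l - zonal_freq l n q) ^ N))"

definition zonal_b :: "real \<Rightarrow> nat \<Rightarrow> nat \<Rightarrow> nat \<Rightarrow> complex" where
  "zonal_b l N L n = of_nat (Suc n) * (- \<i>) ^ Suc n * complex_of_real (\<Sum>q\<le>L. (-1) ^ (L + q) * zonal_wt l L (Suc n) q / 2 *
      ((l + zonal_freq l (Suc n) q) ^ N - (l - zonal_freq l (Suc n) q) ^ N))"

text \<open>With alternating signs the sum over \<open>q\<close> telescopes to \<open>0\<close>, which gives the initial values; without
  signs it gives the Beta integral behind the \<open>J\<^sub>1\<close> terms.\<close>

lemma binomial_pochhammer_split:
  fixes a :: real
  assumes "a > 0"
  shows "of_nat (Suc L choose q) * (a + 2 * real q) / pochhammer (a + real q) (Suc (Suc L)) =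
     of_nat (L choose q) / pochhammer (a + real q + 1) (Suc L) +
     (if q = 0 then 0 else of_nat (L choose (q - 1)) / pochhammer (a + real q) (Suc L))"
proof -
  define P where "P = pochhammer (a + real q + 1) L"
  have P: "P > 0" unfolding P_def using assms by (intro pochhammer_pos) auto
  have 1: "pochhammer (a + real q) (Suc (Suc L)) = (a + real q) * P * (a + real q + real L + 1)"
    unfolding P_def pochhammer_rec[of _ "Suc L"] by (simp add: pochhammer_Suc algebra_simps)
  have 2: "pochhammer (a + real q + 1) (Suc L) = P * (a + real q + real L + 1)"
    unfolding P_def by (simp add: pochhammer_Suc algebra_simps)
  have 3: "pochhammer (a + real q) (Suc L) = (a + real q) * P"
    unfolding P_def by (simp add: pochhammer_rec)
  \<comment> \<open>Pascal's rule combined with the absorption identity q (L choose q) = (L + 1 - q)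
    (L choose (q - 1)). Each of the two resulting terms cancels one end factor of the Pochhammer
    product.\<close>
  have 4: "of_nat (Suc L choose q) * (a + 2 * real q) =
     of_nat (L choose q) * (a + real q) + (if q = 0 then 0 else of_nat (L choose (q - 1))) * (a + real q + real L + 1)"
  proof (cases q)
    case (Suc r)
    have "real (Suc r) * real (Suc L choose Suc r) = real (Suc L) * real (L choose r)"
      by (metis Suc_times_binomial_eq mult.commute of_nat_mult)
    then have "real (Suc r) * real (L choose Suc r) = (real L - real r) * real (L choose r)"
      by (simp add: algebra_simps)
    then show ?thesis using Suc by (simp add: algebra_simps)
  qed simp
  have pos: "a + real q > 0" "a + real q + real L + 1 > 0" using assms by auto
  have split: "(X * A + Y * B) / (A * P * B) = X / (P * B) + Y / (A * P)"
    if "A > 0" "B > 0" for A B X Y :: real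
    using that P by (simp add: add_divide_distrib)
  have "(if q = 0 then 0 else of_nat (L choose (q - 1)) / ((a + real q) * P)) =
      (if q = 0 then 0 else of_nat (L choose (q - 1))) / ((a + real q) * P)" by simp
  then show ?thesis
    unfolding 1 2 3 4 split[OF pos] by simp
qed

lemma zonal_a_0:
  assumes "l > 0"
  shows "zonal_a l 0 L n = (if L = 0 then (- \<i>) ^ n / fact n else 0)"
proof (cases L)
  case 0
  have "zonal_wt l 0 n 0 / 2 * (2 * (real n + l)) = 1 / fact n"
  proof -
    have "real n + l > 0" using assms by simp
    moreover have "1 / (fact n * A) / 2 * (2 * A) = 1 / fact n" if "A > 0" for A :: real
      using that by simp
    moreover have "zonal_wt l 0 n 0 = 1 / (fact n * (real n + l))" by (simp add: zonal_wt_def)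
    ultimately show ?thesis by (simp only:)
  qed
  then have "(\<Sum>q\<le>L. (-1) ^ (L + q) * zonal_wt l L n q / 2 *
      ((zonal_freq l n q - l) * (l + zonal_freq l n q) ^ 0 + (zonal_freq l n q + l) * (l - zonal_freq l n q) ^ 0)) = 1 / fact n"
    using 0 by (simp add: zonal_freq_def algebra_simps)
  then show ?thesis using 0 by (simp add: zonal_a_def)
next
  case (Suc K)
  let ?a = "real n + l"
  define h where "h q = (-1) ^ q * of_nat (K choose q) / pochhammer (?a + real q + 1) (Suc K)" for q
  have a: "?a > 0" using assms by simp
  have "(\<Sum>q\<le>L. (-1) ^ (L + q) * zonal_wt l L n q / 2 *
      ((zonal_freq l n q - l) * (l + zonal_freq l n q) ^ 0 + (zonal_freq l n q + l) * (l - zonal_freq l n q) ^ 0))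
    = (\<Sum>q\<le>Suc K. (-1) ^ Suc K / (4 ^ L * fact n * fact L) * ((-1) ^ q * (of_nat (Suc K choose q) * (?a + 2 * real q)
         / pochhammer (?a + real q) (Suc (Suc K)))))"
  proof (intro sum.cong)
    fix q :: nat
    have "((zonal_freq l n q - l) * (l + zonal_freq l n q) ^ 0 + (zonal_freq l n q + l) * (l - zonal_freq l n q) ^ 0)
       = 2 * (?a + 2 * real q)" by (simp add: zonal_freq_def)
    moreover have "s * (C / (X * P)) / 2 * (2 * v) = t / X * (u * (C * v / P))"
      if "s = t * u" for s t u v C X P :: real
      unfolding that by simp
    moreover have "real n + real q + l = ?a + real q" by simp
    ultimately show "(-1) ^ (L + q) * zonal_wt l L n q / 2 *
      ((zonal_freq l n q - l) * (l + zonal_freq l n q) ^ 0 + (zonal_freq l n q + l) * (l - zonal_freq l n q) ^ 0) =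
      (-1) ^ Suc K / (4 ^ L * fact n * fact L) * ((-1) ^ q * (of_nat (Suc K choose q) * (?a + 2 * real q)
         / pochhammer (?a + real q) (Suc (Suc K))))"
      unfolding zonal_wt_def Suc by (simp only: power_add)
  qed (simp add: Suc)
  also have "\<dots> = (-1) ^ Suc K / (4 ^ L * fact n * fact L) *
      (\<Sum>q\<le>Suc K. h q - (if q = 0 then 0 else h (q - 1)))"
    unfolding binomial_pochhammer_split[OF a] sum_distrib_left
  proof (intro sum.cong refl)
    fix q :: nat
    have "?a + real q + 1 = ?a + real (Suc q)" by simp
    then show "(-1) ^ Suc K / (4 ^ L * fact n * fact L) * ((-1) ^ q * (of_nat (K choose q) / pochhammer (?a + real q + 1) (Suc K) +
        (if q = 0 then 0 else of_nat (K choose (q - 1)) / pochhammer (?a + real q) (Suc K)))) =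
        (-1) ^ Suc K / (4 ^ L * fact n * fact L) * (h q - (if q = 0 then 0 else h (q - 1)))"
      by (cases q) (simp_all add: h_def algebra_simps)
  qed
  \<comment> \<open>The sum telescopes to its last term, which vanishes because K choose (K + 1) is
    0.\<close>
  also have "(\<Sum>q\<le>Suc K. h q - (if q = 0 then 0 else h (q - 1))) = h (Suc K)"
    unfolding sum_subtractf by (subst (2) sum.atMost_Suc_shift) simp
  also have "h (Suc K) = 0" by (simp add: h_def)
  finally show ?thesis using Suc by (simp add: zonal_a_def)
qed

lemma zonal_b_0: "zonal_b l 0 L n = 0"
  by (simp add: zonal_b_def)

text \<open>The link from degree L + 1 in \<rho> to degree L, needed for the term -\<rho> b_p, whose
  two p-derivatives of s explain the shift of n by two. Absorption lowers the binomial coefficient,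
  and the Pochhammer product loses its first factor n + (q + 1) + l.\<close>

lemma zonal_wt_shift:
  assumes "l > 0"
  shows "4 * real (Suc q) * (real n + real (Suc q) + l) * zonal_wt l (Suc L) n (Suc q)
       = real (Suc n) * real (Suc (Suc n)) * zonal_wt l L (Suc (Suc n)) q"
proof -
  define P where "P = pochhammer (real n + real q + l + 2) (Suc L)"
  have P: "P > 0" unfolding P_def using assms by (intro pochhammer_pos) auto
  have 1: "pochhammer (real n + real (Suc q) + l) (Suc (Suc L)) = (real n + real (Suc q) + l) * P"
    unfolding P_def pochhammer_rec[of _ "Suc L"] by (simp add: algebra_simps)
  have 2: "pochhammer (real (Suc (Suc n)) + real q + l) (Suc L) = P"
    unfolding P_def by (simp add: algebra_simps)
  have 3: "real (Suc q) * real (Suc L choose Suc q) = real (Suc L) * real (L choose q)"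
    by (metis Suc_times_binomial_eq mult.commute of_nat_mult)
  have nz: "real n + real (Suc q) + l > 0" using assms by simp
  have "4 * real (Suc q) * (real n + real (Suc q) + l) * zonal_wt l (Suc L) n (Suc q)
     = 4 * (real n + real (Suc q) + l) * (real (Suc q) * real (Suc L choose Suc q)) /
         (4 ^ Suc L * fact n * fact (Suc L) * ((real n + real (Suc q) + l) * P))"
    unfolding zonal_wt_def 1 by (simp only: times_divide_eq_right mult.assoc mult.commute mult.left_commute)
  also have "\<dots> = real (L choose q) / (4 ^ L * fact n * fact L * P)"
  proof -
    have "4 * A * (B * C) / (4 ^ Suc L * D * fact (Suc L) * (A * P)) = C / (4 ^ L * D * fact L * P)"
      if "A > 0" "D > 0" "B = real (Suc L)" for A B C D :: real
      using that P by (simp add: divide_simps del: of_nat_Suc)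
    from this[OF nz, of "fact n" "real (Suc L)" "real (L choose q)"] show ?thesis
      unfolding 3 by simp
  qed
  also have "\<dots> = real (Suc n) * real (Suc (Suc n)) * zonal_wt l L (Suc (Suc n)) q"
    unfolding zonal_wt_def 2 using P by (simp add: divide_simps del: of_nat_Suc)
  finally show ?thesis .
qed

text \<open>Coefficient form of (m - 1) p b + (p^2 - \<rho>) b_p, where m - 1 + (n - 1) = n + 2 l.
  It rests on (v - l) (v + l) = n (n + 2 l) + 4 q (n + q + l): the first summand gives the p-terms,
  the second feeds \<open>zonal_wt_shift\<close>.\<close>

lemma zonal_a_Suc:
  assumes "l > 0"
  shows "zonal_a l (Suc N) L n = (if n = 0 then 0 else complex_of_real (real n + 2 * l) * zonal_b l N L (n - 1))
       - (if L = 0 then 0 else of_nat (Suc n) * zonal_b l N (L - 1) (Suc n))"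
proof -
  define D where "D n q = (l + zonal_freq l n q) ^ N - (l - zonal_freq l n q) ^ N" for n q
  define S where "S L n = (\<Sum>q\<le>L. (-1) ^ (L + q) * zonal_wt l L n q / 2 * D n q)" for L n
  \<comment> \<open>The frequency depends only on n + 2 q, so raising q by one equals raising n by
    two.\<close>
  have D: "D n (Suc q) = D (Suc (Suc n)) q" for q
    by (simp add: D_def zonal_freq_def algebra_simps)
  have "(\<Sum>q\<le>L. (-1) ^ (L + q) * zonal_wt l L n q / 2 *
      ((zonal_freq l n q - l) * (l + zonal_freq l n q) ^ Suc N + (zonal_freq l n q + l) * (l - zonal_freq l n q) ^ Suc N))
    = (\<Sum>q\<le>L. real n * (real n + 2 * l) * ((-1) ^ (L + q) * zonal_wt l L n q / 2 * D n q)
         + (-1) ^ (L + q) * (4 * real q * (real n + real q + l) * zonal_wt l L n q) / 2 * D n q)"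
  proof (intro sum.cong refl)
    fix q :: nat
    have "(zonal_freq l n q - l) * (l + zonal_freq l n q) ^ Suc N + (zonal_freq l n q + l) * (l - zonal_freq l n q) ^ Suc N
       = (zonal_freq l n q - l) * (zonal_freq l n q + l) * D n q"
      by (simp add: D_def algebra_simps)
    also have "(zonal_freq l n q - l) * (zonal_freq l n q + l) = real n * (real n + 2 * l) + 4 * real q * (real n + real q + l)"
      by (simp add: zonal_freq_def algebra_simps)
    finally show "(-1) ^ (L + q) * zonal_wt l L n q / 2 *
      ((zonal_freq l n q - l) * (l + zonal_freq l n q) ^ Suc N + (zonal_freq l n q + l) * (l - zonal_freq l n q) ^ Suc N)
      = real n * (real n + 2 * l) * ((-1) ^ (L + q) * zonal_wt l L n q / 2 * D n q)
         + (-1) ^ (L + q) * (4 * real q * (real n + real q + l) * zonal_wt l L n q) / 2 * D n q"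
      by (simp only:) (simp add: field_simps)
  qed
  also have "\<dots> = real n * (real n + 2 * l) * S L n +
     (\<Sum>q\<le>L. (-1) ^ (L + q) * (4 * real q * (real n + real q + l) * zonal_wt l L n q) / 2 * D n q)"
    by (simp add: S_def sum.distrib sum_distrib_left)
  also have "(\<Sum>q\<le>L. (-1) ^ (L + q) * (4 * real q * (real n + real q + l) * zonal_wt l L n q) / 2 * D n q)
      = (if L = 0 then 0 else real (Suc n) * real (Suc (Suc n)) * S (L - 1) (Suc (Suc n)))"
  proof (cases L)
    case (Suc K)
    have "(\<Sum>q\<le>Suc K. (-1) ^ (Suc K + q) * (4 * real q * (real n + real q + l) * zonal_wt l (Suc K) n q) / 2 * D n q)
        = (\<Sum>q\<le>K. (-1) ^ (K + q) * (real (Suc n) * real (Suc (Suc n)) * zonal_wt l K (Suc (Suc n)) q) / 2 * D (Suc (Suc n)) q)"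
      by (subst sum.atMost_Suc_shift) (simp add: zonal_wt_shift[OF assms] D del: of_nat_Suc)
    also have "\<dots> = real (Suc n) * real (Suc (Suc n)) * S K (Suc (Suc n))"
      by (simp add: S_def sum_distrib_left mult_ac del: of_nat_Suc)
    finally show ?thesis using Suc by simp
  qed simp
  finally have a: "zonal_a l (Suc N) L n = (- \<i>) ^ n * complex_of_real (real n * (real n + 2 * l) * S L n +
      (if L = 0 then 0 else real (Suc n) * real (Suc (Suc n)) * S (L - 1) (Suc (Suc n))))"
    by (simp only: zonal_a_def)
  have b: "zonal_b l N L n = of_nat (Suc n) * (- \<i>) ^ Suc n * complex_of_real (S L (Suc n))" for L n
    by (simp only: zonal_b_def S_def D_def)
  have "(if n = 0 then 0 else complex_of_real (real n + 2 * l) * zonal_b l N L (n - 1))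
      = (- \<i>) ^ n * complex_of_real (real n * (real n + 2 * l) * S L n)"
    by (cases n) (simp_all only: b, simp_all add: mult_ac)
  moreover have "of_nat (Suc n) * zonal_b l N (L - 1) (Suc n)
      = - ((- \<i>) ^ n * complex_of_real (real (Suc n) * real (Suc (Suc n)) * S (L - 1) (Suc (Suc n))))"
    unfolding b of_real_mult of_real_of_nat_eq by (simp add: mult_ac del: of_nat_Suc)
  ultimately show ?thesis
    unfolding a by (simp add: distrib_left)
qed

text \<open>Coefficient form of a_p + (m - 2) b. It holds frequency by frequency, from l + v = (v -
  l) + 2 l and -(l - v) = (v + l) - 2 l.\<close>

lemma zonal_b_Suc:
  "zonal_b l (Suc N) L n = of_nat (Suc n) * zonal_a l N L (Suc n) + complex_of_real (2 * l) * zonal_b l N L n"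
proof -
  define v where "v q = zonal_freq l (Suc n) q" for q
  define w where "w q = (-1) ^ (L + q) * zonal_wt l L (Suc n) q / 2" for q
  have "(\<Sum>q\<le>L. w q * ((l + v q) ^ Suc N - (l - v q) ^ Suc N)) =
     (\<Sum>q\<le>L. w q * ((v q - l) * (l + v q) ^ N + (v q + l) * (l - v q) ^ N)) +
     2 * l * (\<Sum>q\<le>L. w q * ((l + v q) ^ N - (l - v q) ^ N))"
    unfolding sum_distrib_left sum.distrib[symmetric]
    by (intro sum.cong refl) (simp add: algebra_simps)
  then show ?thesis
    unfolding zonal_b_def zonal_a_def v_def[symmetric] w_def[symmetric]
    by (simp only: of_real_add of_real_mult) (simp add: algebra_simps)
qed

section \<open>Interchange of summations and integrals\<close>

lemma exp_has_sum_real: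
  fixes x :: real
  assumes "x \<ge> 0"
  shows "((\<lambda>n. x ^ n / fact n) has_sum exp x) UNIV"
  using exp_converges[of x] assms by (intro sums_nonneg_imp_has_sum) (auto simp: divide_inverse_commute)

lemma summable_on_exp_product:
  fixes x y :: real
  assumes "x \<ge> 0" "y \<ge> 0"
  shows "(\<lambda>(L, n). x ^ L / fact L * (y ^ n / fact n)) summable_on (UNIV :: (nat \<times> nat) set)"
proof -
  have "(\<lambda>(L, n). x ^ L / fact L * (y ^ n / fact n)) summable_on (UNIV \<times> UNIV :: (nat \<times> nat) set)"
  proof (rule summable_on_SigmaI)
    show "((\<lambda>n. case (L, n) of (L, n) \<Rightarrow> x ^ L / fact L * (y ^ n / fact n)) has_sum x ^ L / fact L * exp y) UNIV"
      for L :: nat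
      unfolding prod.case by (intro has_sum_cmult_right exp_has_sum_real assms)
    show "(\<lambda>L. x ^ L / fact L * exp y) summable_on (UNIV :: nat set)"
      using has_sum_cmult_left[OF exp_has_sum_real[OF assms(1)]] by (rule has_sum_imp_summable)
  qed (use assms in auto)
  then show ?thesis by simp
qed

text \<open>Summing the bound over N gives an exponential of an expression linear in n and L, that
  is, a product of geometric factors; these are beaten by n! L!.\<close>

lemma exponential_type_summable:
  fixes c :: "nat \<Rightarrow> nat \<Rightarrow> nat \<Rightarrow> complex" and p r \<tau> :: complex and C \<alpha> \<beta> \<gamma> :: real
  assumes C: "C \<ge> 0" and nonneg: "\<alpha> \<ge> 0" "\<beta> \<ge> 0" "\<gamma> \<ge> 0"
    and bound: "\<And>N L n. norm (c N L n) \<le> C * (\<alpha> + \<beta> * real n + \<gamma> * real L) ^ Suc N / (fact n * fact L)"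
  shows "(\<lambda>((L, n), N). r ^ L * p ^ n * (\<tau> ^ N / fact N * c N L n)) summable_on UNIV"
proof -
  define X where "X L n = \<alpha> + \<beta> * real n + \<gamma> * real L" for L n
  \<comment> \<open>The summand 1 absorbs the extra factor X coming from the exponent N + 1, via X
    \<le> exp X.\<close>
  define \<kappa> where "\<kappa> = 1 + norm \<tau>"
  have X: "X L n \<ge> 0" for L n using nonneg by (simp add: X_def)
  define w where "w L n = norm r ^ L * norm p ^ n * (C / (fact n * fact L))" for L n
  have w: "w L n \<ge> 0" for L n using C by (simp add: w_def)
  have "(\<lambda>((L, n), N). w L n * X L n * ((norm \<tau> * X L n) ^ N / fact N)) summable_on
        ((UNIV :: (nat \<times> nat) set) \<times> (UNIV :: nat set))"
  proof (rule summable_on_SigmaI[where g = "\<lambda>(L, n). w L n * X L n * exp (norm \<tau> * X L n)"])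
    fix ij :: "nat \<times> nat"
    show "((\<lambda>N. (\<lambda>((L, n), N). w L n * X L n * ((norm \<tau> * X L n) ^ N / fact N)) (ij, N)) has_sum
        (case ij of (L, n) \<Rightarrow> w L n * X L n * exp (norm \<tau> * X L n))) UNIV"
    proof -
      obtain L n where ij: "ij = (L, n)" by (cases ij)
      show ?thesis
        unfolding ij prod.case by (intro has_sum_cmult_right exp_has_sum_real mult_nonneg_nonneg norm_ge_zero X)
    qed
  next
    have "(\<lambda>(L, n). C * exp (\<kappa> * \<alpha>) * ((norm r * exp (\<kappa> * \<gamma>)) ^ L / fact L * ((norm p * exp (\<kappa> * \<beta>)) ^ n / fact n)))
        summable_on (UNIV :: (nat \<times> nat) set)"
      using summable_on_cmult_right[OF summable_on_exp_product[of "norm r * exp (\<kappa> * \<gamma>)" "norm p * exp (\<kappa> * \<beta>)"],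
          of "C * exp (\<kappa> * \<alpha>)"]
      by (simp add: case_prod_unfold)
    then show "(\<lambda>(L, n). w L n * X L n * exp (norm \<tau> * X L n)) summable_on UNIV"
    proof (rule summable_on_comparison_test)
      fix ij :: "nat \<times> nat"
      obtain L n where ij: "ij = (L, n)" by (cases ij)
      have "X L n \<le> exp (X L n)" using exp_ge_add_one_self[of "X L n"] by linarith
      then have "X L n * exp (norm \<tau> * X L n) \<le> exp (X L n) * exp (norm \<tau> * X L n)"
        by (intro mult_right_mono) auto
      also have "\<dots> = exp (\<kappa> * \<alpha>) * exp (\<kappa> * \<gamma>) ^ L * exp (\<kappa> * \<beta>) ^ n"
        unfolding X_def \<kappa>_def by (simp flip: exp_add exp_of_nat_mult) (simp add: algebra_simps)
      finally have "w L n * (X L n * exp (norm \<tau> * X L n)) \<le> w L n * (exp (\<kappa> * \<alpha>) * exp (\<kappa> * \<gamma>) ^ L * exp (\<kappa> * \<beta>) ^ n)"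
        by (intro mult_left_mono w)
      also have "\<dots> = C * exp (\<kappa> * \<alpha>) * ((norm r * exp (\<kappa> * \<gamma>)) ^ L / fact L * ((norm p * exp (\<kappa> * \<beta>)) ^ n / fact n))"
        by (simp add: w_def power_mult_distrib mult_ac)
      finally show "(case ij of (L, n) \<Rightarrow> w L n * X L n * exp (norm \<tau> * X L n)) \<le>
          (case ij of (L, n) \<Rightarrow> C * exp (\<kappa> * \<alpha>) * ((norm r * exp (\<kappa> * \<gamma>)) ^ L / fact L * ((norm p * exp (\<kappa> * \<beta>)) ^ n / fact n)))"
        by (simp add: ij mult.assoc)
      show "0 \<le> (case ij of (L, n) \<Rightarrow> w L n * X L n * exp (norm \<tau> * X L n))"
        using w X by (simp add: ij)
    qed
  next
    fix ij :: "nat \<times> nat" and N :: nat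
    show "0 \<le> (\<lambda>((L, n), N). w L n * X L n * ((norm \<tau> * X L n) ^ N / fact N)) (ij, N)"
      using w X by (cases ij) auto
  qed
  then have "(\<lambda>((L, n), N). w L n * X L n * ((norm \<tau> * X L n) ^ N / fact N)) summable_on UNIV" by simp
  then have "(\<lambda>x. norm ((\<lambda>((L, n), N). r ^ L * p ^ n * (\<tau> ^ N / fact N * c N L n)) x)) summable_on UNIV"
  proof (rule Infinite_Sum.abs_summable_on_comparison_test')
    fix x :: "(nat \<times> nat) \<times> nat"
    obtain L n N where x: "x = ((L, n), N)" by (metis prod.exhaust)
    have "norm (r ^ L * p ^ n * (\<tau> ^ N / fact N * c N L n)) =
        norm r ^ L * norm p ^ n * (norm \<tau> ^ N / fact N * norm (c N L n))"
      by (simp add: norm_mult norm_power norm_divide)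
    also have "\<dots> \<le> norm r ^ L * norm p ^ n * (norm \<tau> ^ N / fact N * (C * X L n ^ Suc N / (fact n * fact L)))"
      using bound[of N L n] unfolding X_def by (intro mult_left_mono) auto
    also have "\<dots> = w L n * X L n * ((norm \<tau> * X L n) ^ N / fact N)"
      by (simp add: w_def power_mult_distrib mult_ac)
    finally show "norm ((\<lambda>((L, n), N). r ^ L * p ^ n * (\<tau> ^ N / fact N * c N L n)) x) \<le>
        (\<lambda>((L, n), N). w L n * X L n * ((norm \<tau> * X L n) ^ N / fact N)) x"
      by (simp add: x)
  qed
  then show ?thesis by (rule abs_summable_summable)
qed

text \<open>One summable triple family is summed in two orders: over N first, which gives the values
  \<open>T\<close>, and over n, then L, then N, which gives the operator series.\<close>

lemma exponential_type_interchange: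
  fixes c :: "nat \<Rightarrow> nat \<Rightarrow> nat \<Rightarrow> complex" and p r \<tau> :: complex and C \<alpha> \<beta> \<gamma> :: real
  assumes "C \<ge> 0" "\<alpha> \<ge> 0" "\<beta> \<ge> 0" "\<gamma> \<ge> 0"
    and "\<And>N L n. norm (c N L n) \<le> C * (\<alpha> + \<beta> * real n + \<gamma> * real L) ^ Suc N / (fact n * fact L)"
    and row: "\<And>N L. (\<lambda>n. c N L n * p ^ n) sums e N L"
    and row0: "\<And>N L. L > N \<Longrightarrow> e N L = 0"
    and col: "\<And>L n. (\<lambda>N. \<tau> ^ N / fact N * c N L n) sums T L n"
  obtains Z where "(\<lambda>N. \<tau> ^ N / fact N * (\<Sum>L\<le>N. r ^ L * e N L)) sums Z"
    and "((\<lambda>(L, n). r ^ L * p ^ n * T L n) has_sum Z) UNIV"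
proof -
  define g where "g = (\<lambda>((L, n), N). r ^ L * p ^ n * (\<tau> ^ N / fact N * c N L n))"
  have "g summable_on UNIV"
    unfolding g_def using assms(1-5) by (rule exponential_type_summable)
  then have g: "g summable_on (UNIV \<times> UNIV)" by simp
  define Z where "Z = infsum g (UNIV \<times> UNIV)"
  have Z: "(g has_sum Z) (UNIV \<times> UNIV)" using g by (simp add: Z_def)
  have "((\<lambda>(L, n). r ^ L * p ^ n * T L n) has_sum Z) UNIV"
  proof (rule has_sum_SigmaD[OF Z])
    fix ij :: "nat \<times> nat"
    obtain L n where ij: "ij = (L, n)" by (cases ij)
    have "(\<lambda>N. g (ij, N)) summable_on UNIV"
      by (rule summable_on_SigmaD1[where f = "\<lambda>x y. g (x, y)" and A = UNIV]) (use g in auto)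
    then obtain s where s: "((\<lambda>N. g (ij, N)) has_sum s) UNIV" by (auto simp: summable_on_def)
    have "(\<lambda>N. g (ij, N)) sums (r ^ L * p ^ n * T L n)"
      unfolding ij g_def prod.case by (intro sums_mult col)
    with has_sum_imp_sums[OF s] have "s = r ^ L * p ^ n * T L n" by (rule sums_unique2)
    with s show "((\<lambda>N. g (ij, N)) has_sum (case ij of (L, n) \<Rightarrow> r ^ L * p ^ n * T L n)) UNIV"
      by (simp only: ij prod.case)
  qed
  moreover have "((\<lambda>N. \<tau> ^ N / fact N * (\<Sum>L\<le>N. r ^ L * e N L)) has_sum Z) UNIV"
  proof (rule has_sum_SigmaD)
    show "((\<lambda>(N, ij). g (ij, N)) has_sum Z) (UNIV \<times> UNIV)"
      using Z by (rule has_sum_swap[THEN iffD1])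
    then have sw: "(\<lambda>(N, ij). g (ij, N)) summable_on (UNIV \<times> UNIV)" by (rule has_sum_imp_summable)
    fix N :: nat
    have "(\<lambda>ij. g (ij, N)) summable_on UNIV"
      by (rule summable_on_SigmaD1[where f = "\<lambda>N ij. g (ij, N)" and A = UNIV]) (use sw in auto)
    then obtain s where s: "((\<lambda>ij. g (ij, N)) has_sum s) (UNIV \<times> UNIV)" by (auto simp: summable_on_def)
    have "((\<lambda>L. \<tau> ^ N / fact N * (r ^ L * e N L)) has_sum s) UNIV"
    proof (rule has_sum_SigmaD[OF s])
      fix L :: nat
      have "(\<lambda>n. g ((L, n), N)) summable_on UNIV"
        by (rule summable_on_SigmaD1[where f = "\<lambda>L n. g ((L, n), N)" and A = UNIV])
          (use has_sum_imp_summable[OF s] in \<open>simp_all add: case_prod_unfold\<close>)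
      then obtain s' where s': "((\<lambda>n. g ((L, n), N)) has_sum s') UNIV" by (auto simp: summable_on_def)
      have "(\<lambda>n. (\<tau> ^ N / fact N * r ^ L) * (c N L n * p ^ n)) sums ((\<tau> ^ N / fact N * r ^ L) * e N L)"
        by (intro sums_mult row)
      then have "(\<lambda>n. g ((L, n), N)) sums (\<tau> ^ N / fact N * (r ^ L * e N L))"
        unfolding g_def prod.case by (simp add: mult_ac)
      with has_sum_imp_sums[OF s'] have "s' = \<tau> ^ N / fact N * (r ^ L * e N L)" by (rule sums_unique2)
      with s' show "((\<lambda>n. g ((L, n), N)) has_sum \<tau> ^ N / fact N * (r ^ L * e N L)) UNIV"
        by (simp only:)
    qed
    \<comment> \<open>Here \<open>row0\<close> makes the sum over all L a finite sum up to
      N.\<close>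
    moreover have "((\<lambda>L. \<tau> ^ N / fact N * (r ^ L * e N L)) has_sum (\<Sum>L\<le>N. \<tau> ^ N / fact N * (r ^ L * e N L))) UNIV"
      by (rule has_sum_finite_neutralI) (auto simp: row0 not_le)
    ultimately have "s = \<tau> ^ N / fact N * (\<Sum>L\<le>N. r ^ L * e N L)"
      unfolding sum_distrib_left by (rule has_sum_unique)
    with s show "((\<lambda>y. case (N, y) of (N, ij) \<Rightarrow> g (ij, N)) has_sum \<tau> ^ N / fact N * (\<Sum>L\<le>N. r ^ L * e N L)) UNIV"
      by simp
  qed
  ultimately show ?thesis using has_sum_imp_sums that by blast
qed

text \<open>Growing rectangles eventually contain every finite set of indices. The two side lengths
  are independent because the range of L will be one longer than that of n.\<close>

lemma has_sum_rectangles: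
  fixes h :: "nat \<Rightarrow> nat \<Rightarrow> 'a :: {comm_monoid_add, topological_space}"
  assumes "((\<lambda>(L, n). h L n) has_sum Z) UNIV"
    and M: "filterlim M at_top sequentially" and M': "filterlim M' at_top sequentially"
  shows "(\<lambda>K. \<Sum>L<M K. \<Sum>n<M' K. h L n) \<longlonglongrightarrow> Z"
proof -
  have "filterlim (\<lambda>K. {..<M K} \<times> {..<M' K}) (finite_subsets_at_top UNIV) sequentially"
    unfolding filterlim_finite_subsets_at_top
  proof safe
    fix X :: "(nat \<times> nat) set" assume "finite X"
    then have fin: "finite (fst ` X)" "finite (snd ` X)" by auto
    have "\<forall>\<^sub>F K in sequentially. Suc (Max (insert 0 (fst ` X))) \<le> M K \<and> Suc (Max (insert 0 (snd ` X))) \<le> M' K"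
      using M M' unfolding filterlim_at_top by (intro eventually_conj) blast+
    then show "\<forall>\<^sub>F K in sequentially. finite ({..<M K} \<times> {..<M' K}) \<and> X \<subseteq> {..<M K} \<times> {..<M' K} \<and>
        {..<M K} \<times> {..<M' K} \<subseteq> UNIV"
    proof eventually_elim
      case (elim K)
      have "fst x < M K" "snd x < M' K" if "x \<in> X" for x
      proof -
        have "fst x \<le> Max (insert 0 (fst ` X))" "snd x \<le> Max (insert 0 (snd ` X))"
          using fin that by auto
        with elim show "fst x < M K" "snd x < M' K" by linarith+
      qed
      then show ?case by force
    qed
  qed
  with assms(1) have "((\<lambda>K. sum (\<lambda>(L, n). h L n) ({..<M K} \<times> {..<M' K})) \<longlongrightarrow> Z) sequentially"
    unfolding has_sum_def by (rule filterlim_compose)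
  then show ?thesis by (simp add: sum.cartesian_product)
qed

section \<open>Beta integrals and dominated convergence\<close>

definition beta_sum :: "nat \<Rightarrow> real \<Rightarrow> real" where
  "beta_sum L a = (\<Sum>q\<le>L. of_nat (L choose q) / pochhammer (a + real q) (Suc L))"

lemma powr_mult_power:
  fixes u :: real
  assumes "u \<ge> 0"
  shows "u powr b * u ^ n = u powr (b + real n)"
  using assms by (cases "u = 0") (auto simp: powr_add powr_realpow)

text \<open>Write (1 - u^2)^L = (1 + u)^L (1 - u)^L and expand only the first factor: each term is a
  Beta integral, and the Pochhammer denominators are those of \<open>zonal_wt\<close>.\<close>

lemma beta_sum_has_integral:
  assumes a: "a > 0"
  shows "((\<lambda>u. u powr (a - 1) * (1 - u\<^sup>2) ^ L) has_integral fact L * beta_sum L a) {0..1}"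
proof -
  have B: "Beta (a + real q) (real (Suc L)) = fact L / pochhammer (a + real q) (Suc L)" for q
  proof -
    have nz: "a + real q \<notin> \<int>\<^sub>\<le>\<^sub>0" using a by (auto simp: nonpos_Ints_def)
    have "Gamma (real (Suc L)) = fact L" using Gamma_fact[of L, where 'a = real] by (simp add: add.commute)
    then show ?thesis
      unfolding Beta_def pochhammer_Gamma[OF nz] by simp
  qed
  have "((\<lambda>u. \<Sum>q\<le>L. of_nat (L choose q) * (u powr (a + real q - 1) * (1 - u) powr (real (Suc L) - 1)))
      has_integral (\<Sum>q\<le>L. of_nat (L choose q) * Beta (a + real q) (real (Suc L)))) {0..1}"
    using a by (intro has_integral_sum has_integral_mult_right has_integral_Beta_real) auto
  also have "(\<Sum>q\<le>L. of_nat (L choose q) * Beta (a + real q) (real (Suc L))) = fact L * beta_sum L a"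
    unfolding B beta_sum_def by (simp add: sum_distrib_left mult.commute)
  finally show ?thesis
  \<comment> \<open>At u = 1 and L = 0 the integrands differ, as \<open>0 powr 0\<close> is 0 while
    \<open>0 ^ 0\<close> is 1; the endpoints are set aside.\<close>
  proof (rule has_integral_spike_finite[rotated 2])
    fix u :: real assume u: "u \<in> {0..1} - {0, 1}"
    have "(\<Sum>q\<le>L. of_nat (L choose q) * (u powr (a + real q - 1) * (1 - u) powr (real (Suc L) - 1)))
        = (\<Sum>q\<le>L. of_nat (L choose q) * (u powr (a - 1) * u ^ q * (1 - u) ^ L))"
      using u powr_realpow[of "1 - u" L] powr_mult_power[of u "a - 1"]
      by (intro sum.cong refl) (simp add: algebra_simps)
    also have "\<dots> = u powr (a - 1) * ((\<Sum>q\<le>L. of_nat (L choose q) * u ^ q * 1 ^ (L - q)) * (1 - u) ^ L)"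
      by (simp add: sum_distrib_left sum_distrib_right mult_ac)
    also have "(\<Sum>q\<le>L. of_nat (L choose q) * u ^ q * 1 ^ (L - q)) = (u + 1) ^ L"
      by (simp only: binomial_ring)
    also have "(u + 1) ^ L * (1 - u) ^ L = (1 - u\<^sup>2) ^ L"
      by (simp flip: power_mult_distrib) (simp add: algebra_simps power2_eq_square)
    finally show "u powr (a - 1) * (1 - u\<^sup>2) ^ L =
        (\<Sum>q\<le>L. of_nat (L choose q) * (u powr (a + real q - 1) * (1 - u) powr (real (Suc L) - 1)))" ..
  qed auto
qed

text \<open>Both u and 1 - u^2 lie in [0, 1], so partial sums are bounded by the sums of absolute
  coefficients. The majorant is a constant times \<open>u powr (a - 1)\<close>, integrable because a
  > 0.\<close>

lemma tendsto_integral_double_series: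
  fixes \<alpha> \<beta> :: "nat \<Rightarrow> real"
  assumes a: "a > 0" and \<alpha>: "summable (\<lambda>L. \<bar>\<alpha> L\<bar>)" and \<beta>: "summable (\<lambda>n. \<bar>\<beta> n\<bar>)"
    and M: "filterlim M at_top sequentially" and M': "filterlim M' at_top sequentially"
  shows "(\<lambda>K. \<Sum>L<M K. \<Sum>n<M' K. \<alpha> L * \<beta> n * (fact L * beta_sum L (a + real n)))
     \<longlonglongrightarrow> integral {0..1} (\<lambda>u. u powr (a - 1) * (\<Sum>L. \<alpha> L * (1 - u\<^sup>2) ^ L) * (\<Sum>n. \<beta> n * u ^ n))"
proof -
  define f where "f K u = u powr (a - 1) * (\<Sum>L<M K. \<alpha> L * (1 - u\<^sup>2) ^ L) * (\<Sum>n<M' K. \<beta> n * u ^ n)" for K u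
  have I: "(f K has_integral (\<Sum>L<M K. \<Sum>n<M' K. \<alpha> L * \<beta> n * (fact L * beta_sum L (a + real n)))) {0..1}" for K
  proof -
    have "((\<lambda>u. \<Sum>L<M K. \<Sum>n<M' K. \<alpha> L * \<beta> n * (u powr (a + real n - 1) * (1 - u\<^sup>2) ^ L)) has_integral
       (\<Sum>L<M K. \<Sum>n<M' K. \<alpha> L * \<beta> n * (fact L * beta_sum L (a + real n)))) {0..1}"
      using a by (intro has_integral_sum has_integral_mult_right beta_sum_has_integral) auto
    then show ?thesis
    proof (rule has_integral_eq[rotated])
      fix u :: real assume "u \<in> {0..1}"
      then have *: "u powr (a + real n - 1) = u powr (a - 1) * u ^ n" for n
        using powr_mult_power[of u "a - 1" n] by (simp add: algebra_simps)
      show "(\<Sum>L<M K. \<Sum>n<M' K. \<alpha> L * \<beta> n * (u powr (a + real n - 1) * (1 - u\<^sup>2) ^ L)) = f K u"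
      proof -
        have "f K u = u powr (a - 1) * (\<Sum>L<M K. \<Sum>n<M' K. \<alpha> L * (1 - u\<^sup>2) ^ L * (\<beta> n * u ^ n))"
          unfolding f_def by (simp only: mult.assoc sum_product)
        then show ?thesis
          unfolding * by (simp add: sum_distrib_left mult_ac)
      qed
    qed
  qed
  have le1: "\<bar>v ^ k\<bar> \<le> 1" if "v \<in> {0..1}" for v :: real and k
    using that by (simp add: power_abs power_le_one)
  have sm: "summable (\<lambda>k. \<bar>c k * v ^ k\<bar>)" and bd: "\<bar>\<Sum>k<J. c k * v ^ k\<bar> \<le> (\<Sum>k. \<bar>c k\<bar>)"
    if c: "summable (\<lambda>k. \<bar>c k\<bar>)" and v: "v \<in> {0..1}" for c :: "nat \<Rightarrow> real" and v J
  proof -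
    have le: "\<bar>c k * v ^ k\<bar> \<le> \<bar>c k\<bar>" for k
      using mult_left_mono[OF le1[OF v, of k], of "\<bar>c k\<bar>"] by (simp add: abs_mult)
    show "summable (\<lambda>k. \<bar>c k * v ^ k\<bar>)"
      by (rule summable_comparison_test'[OF c]) (simp add: le)
    have "\<bar>\<Sum>k<J. c k * v ^ k\<bar> \<le> (\<Sum>k<J. \<bar>c k\<bar>)"
      by (rule order_trans[OF sum_abs]) (intro sum_mono le)
    also have "\<dots> \<le> (\<Sum>k. \<bar>c k\<bar>)" by (rule sum_le_suminf[OF c]) auto
    finally show "\<bar>\<Sum>k<J. c k * v ^ k\<bar> \<le> (\<Sum>k. \<bar>c k\<bar>)" .
  qed
  have sq: "1 - u\<^sup>2 \<in> {0..1}" if "u \<in> {0..1}" for u :: real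
    using that by (simp add: power_le_one)
  have "(\<lambda>K. integral {0..1} (f K)) \<longlonglongrightarrow>
      integral {0..1} (\<lambda>u. u powr (a - 1) * (\<Sum>L. \<alpha> L * (1 - u\<^sup>2) ^ L) * (\<Sum>n. \<beta> n * u ^ n))"
  proof (rule dominated_convergence(2))
    show "f K integrable_on {0..1}" for K using I by blast
    show "(\<lambda>u. u powr (a - 1) * ((\<Sum>k. \<bar>\<alpha> k\<bar>) * (\<Sum>k. \<bar>\<beta> k\<bar>))) integrable_on {0..1}"
      using beta_sum_has_integral[OF a, of 0] by (intro integrable_on_mult_left) auto
    fix K and u :: real assume u: "u \<in> {0..1}"
    have "norm (f K u) = u powr (a - 1) * (\<bar>\<Sum>L<M K. \<alpha> L * (1 - u\<^sup>2) ^ L\<bar> * \<bar>\<Sum>n<M' K. \<beta> n * u ^ n\<bar>)"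
      by (simp add: f_def abs_mult)
    also have "\<dots> \<le> u powr (a - 1) * ((\<Sum>k. \<bar>\<alpha> k\<bar>) * (\<Sum>k. \<bar>\<beta> k\<bar>))"
      by (intro mult_left_mono mult_mono bd[OF \<alpha> sq[OF u]] bd[OF \<beta> u] suminf_nonneg[OF \<alpha>]) auto
    finally show "norm (f K u) \<le> u powr (a - 1) * ((\<Sum>k. \<bar>\<alpha> k\<bar>) * (\<Sum>k. \<bar>\<beta> k\<bar>))" .
  next
    fix u :: real assume u: "u \<in> {0..1}"
    have "(\<lambda>J. \<Sum>L<J. \<alpha> L * (1 - u\<^sup>2) ^ L) \<longlonglongrightarrow> (\<Sum>L. \<alpha> L * (1 - u\<^sup>2) ^ L)"
      by (rule summable_LIMSEQ[OF summable_rabs_cancel[OF sm[OF \<alpha> sq[OF u]]]])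
    moreover have "(\<lambda>J. \<Sum>n<J. \<beta> n * u ^ n) \<longlonglongrightarrow> (\<Sum>n. \<beta> n * u ^ n)"
      by (rule summable_LIMSEQ[OF summable_rabs_cancel[OF sm[OF \<beta> u]]])
    ultimately show "(\<lambda>K. f K u) \<longlonglongrightarrow> u powr (a - 1) * (\<Sum>L. \<alpha> L * (1 - u\<^sup>2) ^ L) * (\<Sum>n. \<beta> n * u ^ n)"
      unfolding f_def by (intro tendsto_mult tendsto_const filterlim_compose[OF _ M] filterlim_compose[OF _ M'])
  qed
  moreover have "integral {0..1} (f K) = (\<Sum>L<M K. \<Sum>n<M' K. \<alpha> L * \<beta> n * (fact L * beta_sum L (a + real n)))" for K
    using I by (rule integral_unique)
  ultimately show ?thesis by simp
qed

section \<open>Evaluation at a quarter turn\<close>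

text \<open>Both families have the same initial values and obey the same recursion, once m - 2 is
  written as 2 l.\<close>

lemma Gamma_fps_nth:
  assumes l: "l = real m / 2 - 1" "l > 0"
  shows "fps_nth (fst (Gamma_fps m N L)) n = zonal_a l N L n \<and> fps_nth (snd (Gamma_fps m N L)) n = zonal_b l N L n"
proof (induction N arbitrary: L n)
  case 0
  then show ?case using l by (simp add: zonal_a_0 zonal_b_0)
next
  case (Suc N)
  have m: "of_nat m - 2 = complex_of_real (2 * l)" by (simp add: l)
  have 1: "fps_nth (fst (Gamma_fps m (Suc N) L)) n = zonal_a l (Suc N) L n"
  proof (cases n)
    case 0
    then show ?thesis using l by (simp add: Suc.IH zonal_a_Suc mult.assoc)
  next
    case (Suc k)
    have "fps_nth (fst (Gamma_fps m (Suc N) L)) n =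
        (of_nat m - 1) * zonal_b l N L k + of_nat k * zonal_b l N L k
        - (if L = 0 then 0 else of_nat (Suc n) * zonal_b l N (L - 1) (Suc n))"
      using Suc by (cases k) (simp_all add: Suc.IH mult.assoc fps_X_mult_nth)
    also have "(of_nat m - 1) * zonal_b l N L k + of_nat k * zonal_b l N L k =
        complex_of_real (real n + 2 * l) * zonal_b l N L k"
      using Suc by (simp add: algebra_simps l)
    finally show ?thesis using Suc l by (simp add: zonal_a_Suc)
  qed
  have "fps_nth (snd (Gamma_fps m (Suc N) L)) n = zonal_b l (Suc N) L n"
    unfolding zonal_b_Suc by (simp add: Suc.IH m)
  with 1 show ?case ..
qed

section \<open>Growth bounds for the Taylor coefficients\<close>

lemma zonal_wt_nonneg: "l > 0 \<Longrightarrow> zonal_wt l L n q \<ge> 0"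
  unfolding zonal_wt_def by (intro divide_nonneg_nonneg mult_nonneg_nonneg pochhammer_nonneg) auto

text \<open>The Pochhammer product is at least l: its first factor is at least l, and the others
  dominate those of L!. Weakening 4^L to 2^L leaves just enough to cancel the binomial row
  sum.\<close>

lemma sum_zonal_wt_le:
  assumes l: "l > 0"
  shows "(\<Sum>q\<le>L. zonal_wt l L n q) \<le> 1 / l / (fact n * fact L)"
proof -
  have P: "pochhammer (real n + real q + l) (Suc L) \<ge> l" for q
  proof -
    have "pochhammer (1::real) L \<le> pochhammer (real n + real q + l + 1) L"
      using l unfolding pochhammer_prod by (intro prod_mono) auto
    then have "1 \<le> pochhammer (real n + real q + l + 1) L"
      using fact_ge_1[of L, where 'a = real] unfolding pochhammer_fact by linarith
    then have "l * 1 \<le> (real n + real q + l) * pochhammer (real n + real q + l + 1) L"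
      using l by (intro mult_mono) auto
    then show ?thesis by (simp add: pochhammer_rec)
  qed
  have "zonal_wt l L n q \<le> of_nat (L choose q) * (1 / (2 ^ L * fact n * fact L * l))" for q
  proof -
    have "2 ^ L * fact n * fact L * l \<le> 4 ^ L * fact n * fact L * pochhammer (real n + real q + l) (Suc L)"
      using l P[of q] by (intro mult_mono power_mono) auto
    then have "1 / (4 ^ L * fact n * fact L * pochhammer (real n + real q + l) (Suc L)) \<le> 1 / (2 ^ L * fact n * fact L * l)"
      using l by (intro divide_left_mono) (auto intro!: mult_pos_pos pochhammer_pos)
    then have "of_nat (L choose q) * (1 / (4 ^ L * fact n * fact L * pochhammer (real n + real q + l) (Suc L)))
        \<le> of_nat (L choose q) * (1 / (2 ^ L * fact n * fact L * l))"
      by (intro mult_left_mono) auto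
    then show ?thesis by (simp add: zonal_wt_def)
  qed
  then have "(\<Sum>q\<le>L. zonal_wt l L n q) \<le> (\<Sum>q\<le>L. of_nat (L choose q) * (1 / (2 ^ L * fact n * fact L * l)))"
    by (intro sum_mono)
  also have "\<dots> = (\<Sum>q\<le>L. of_nat (L choose q)) * (1 / (2 ^ L * fact n * fact L * l))"
    by (simp only: sum_distrib_right)
  also have "(\<Sum>q\<le>L. real (L choose q)) = 2 ^ L"
    using choose_row_sum[of L] by (metis of_nat_numeral of_nat_power of_nat_sum)
  also have "2 ^ L * (1 / (2 ^ L * fact n * fact L * l)) = 1 / l / (fact n * fact L)"
    by simp
  finally show ?thesis .
qed

lemma sum_zonal_wt_abs_le:
  assumes l: "l > 0" and f: "\<And>q. q \<le> L \<Longrightarrow> \<bar>f q\<bar> \<le> 2 * B"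
  shows "\<bar>\<Sum>q\<le>L. (-1) ^ (L + q) * zonal_wt l L n q / 2 * f q\<bar> \<le> 1 / l * B / (fact n * fact L)"
proof -
  have B: "B \<ge> 0" using f[of 0] by simp
  have "\<bar>\<Sum>q\<le>L. (-1) ^ (L + q) * zonal_wt l L n q / 2 * f q\<bar> \<le> (\<Sum>q\<le>L. zonal_wt l L n q * B)"
  proof (rule order_trans[OF sum_abs], intro sum_mono)
    fix q assume "q \<in> {..L}"
    then have "zonal_wt l L n q / 2 * \<bar>f q\<bar> \<le> zonal_wt l L n q / 2 * (2 * B)"
      using f zonal_wt_nonneg[OF l] by (intro mult_left_mono) auto
    then show "\<bar>(-1) ^ (L + q) * zonal_wt l L n q / 2 * f q\<bar> \<le> zonal_wt l L n q * B"
      using zonal_wt_nonneg[OF l, of L n q] by (simp add: abs_mult power_abs)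
  qed
  also have "\<dots> = (\<Sum>q\<le>L. zonal_wt l L n q) * B" by (simp only: sum_distrib_right)
  also have "\<dots> \<le> 1 / l / (fact n * fact L) * B"
    by (intro mult_right_mono sum_zonal_wt_le l B)
  finally show ?thesis by simp
qed

lemma abs_sum_two_powers_le:
  fixes v w x y X :: real
  assumes "\<bar>v\<bar> \<le> X" "\<bar>w\<bar> \<le> X" "\<bar>x\<bar> \<le> X" "\<bar>y\<bar> \<le> X"
  shows "\<bar>v * x ^ N + w * y ^ N\<bar> \<le> 2 * X ^ Suc N"
proof -
  have "\<bar>v * x ^ N\<bar> \<le> X * X ^ N" "\<bar>w * y ^ N\<bar> \<le> X * X ^ N"
    using assms by (auto simp: abs_mult power_abs intro!: mult_mono power_mono)
  then show ?thesis using abs_triangle_ineq[of "v * x ^ N" "w * y ^ N"] by simp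
qed

lemma norm_zonal_a_le:
  assumes l: "l > 0"
  shows "norm (zonal_a l N L n) \<le> 1 / l * ((2 * l + 2) + 2 * real n + 4 * real L) ^ Suc N / (fact n * fact L)"
proof -
  have "norm (zonal_a l N L n) = \<bar>\<Sum>q\<le>L. (-1) ^ (L + q) * zonal_wt l L n q / 2 *
      ((zonal_freq l n q - l) * (l + zonal_freq l n q) ^ N + (zonal_freq l n q + l) * (l - zonal_freq l n q) ^ N)\<bar>"
    unfolding zonal_a_def norm_mult norm_of_real by (simp add: norm_power)
  also have "\<dots> \<le> 1 / l * ((2 * l + 2) + 2 * real n + 4 * real L) ^ Suc N / (fact n * fact L)"
    using l by (intro sum_zonal_wt_abs_le abs_sum_two_powers_le) (auto simp: zonal_freq_def)
  finally show ?thesis .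
qed

lemma norm_zonal_b_le:
  assumes l: "l > 0"
  shows "norm (zonal_b l N L n) \<le> 1 / l * ((2 * l + 2) + 2 * real n + 4 * real L) ^ Suc N / (fact n * fact L)"
proof -
  \<comment> \<open>The summand 2 leaves room for the shifted index n + 1 and keeps X at least 1, so
    that one bound serves \<open>zonal_a\<close> and \<open>zonal_b\<close> alike.\<close>
  define X where "X = (2 * l + 2) + 2 * real n + 4 * real L"
  have X: "X \<ge> 1" using l by (simp add: X_def)
  have "norm (zonal_b l N L n) = real (Suc n) * \<bar>\<Sum>q\<le>L. (-1) ^ (L + q) * zonal_wt l L (Suc n) q / 2 *
      ((l + zonal_freq l (Suc n) q) ^ N - (l - zonal_freq l (Suc n) q) ^ N)\<bar>"
    unfolding zonal_b_def norm_mult norm_of_real norm_of_nat by (simp add: norm_power del: power_Suc)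
  also have "\<dots> \<le> real (Suc n) * (1 / l * X ^ Suc N / (fact (Suc n) * fact L))"
  proof (intro mult_left_mono sum_zonal_wt_abs_le l)
    fix q assume q: "q \<le> L"
    have "\<bar>1 * (l + zonal_freq l (Suc n) q) ^ N + (-1) * (l - zonal_freq l (Suc n) q) ^ N\<bar> \<le> 2 * X ^ Suc N"
      using l X q by (intro abs_sum_two_powers_le) (auto simp: zonal_freq_def X_def)
    then show "\<bar>(l + zonal_freq l (Suc n) q) ^ N - (l - zonal_freq l (Suc n) q) ^ N\<bar> \<le> 2 * X ^ Suc N"
      by simp
  qed simp
  also have "\<dots> = 1 / l * X ^ Suc N / (fact n * fact L)" by (simp add: divide_simps del: of_nat_Suc)
  finally show ?thesis by (simp add: X_def)
qed

section \<open>The exponential series in t at t = i pi/2\<close>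

lemma exp_sums_complex: "(\<lambda>N. z ^ N / fact N) sums exp (z :: complex)"
  using exp_converges[of z] by (simp add: scaleR_conv_of_real divide_inverse mult.commute)

lemma weighted_exp_sums:
  fixes \<tau> :: complex and c v w x y :: "nat \<Rightarrow> real"
  shows "(\<lambda>N. \<tau> ^ N / fact N * (K * complex_of_real (\<Sum>q\<le>L. c q * (v q * x q ^ N + w q * y q ^ N)))) sums
     (K * (\<Sum>q\<le>L. complex_of_real (c q) * (complex_of_real (v q) * exp (\<tau> * complex_of_real (x q))
         + complex_of_real (w q) * exp (\<tau> * complex_of_real (y q)))))"
proof -
  have "(\<lambda>N. K * (\<Sum>q\<le>L. complex_of_real (c q) * (complex_of_real (v q) * ((\<tau> * complex_of_real (x q)) ^ N / fact N)
         + complex_of_real (w q) * ((\<tau> * complex_of_real (y q)) ^ N / fact N)))) sums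
     (K * (\<Sum>q\<le>L. complex_of_real (c q) * (complex_of_real (v q) * exp (\<tau> * complex_of_real (x q))
         + complex_of_real (w q) * exp (\<tau> * complex_of_real (y q)))))"
    by (intro sums_mult sums_sum sums_add exp_sums_complex)
  then show ?thesis
    by (rule back_subst[where P = "\<lambda>f. f sums _"])
      (simp add: fun_eq_iff sum_distrib_left power_mult_distrib algebra_simps add_divide_distrib)
qed

text \<open>As l + v = 2 l + n + 2 q and l - v = -(n + 2 q), only integer powers of exp \<tau> = i
  occur besides the single phase e^(i pi l).\<close>

lemma quarter_turn_exp:
  assumes \<tau>: "\<tau> = \<i> * complex_of_real pi / 2"
  shows "exp (\<tau> * complex_of_real (l + zonal_freq l n q)) = exp (\<i> * complex_of_real (pi * l)) * \<i> ^ n * (-1) ^ q"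
    and "exp (\<tau> * complex_of_real (l - zonal_freq l n q)) = (- \<i>) ^ n * (-1) ^ q"
proof -
  have e: "exp \<tau> = \<i>" using cis_pi_half by (simp add: \<tau> cis_conv_exp mult.commute)
  have e': "exp (- \<tau>) = - \<i>" by (simp add: exp_minus e)
  have "\<tau> * complex_of_real (l + zonal_freq l n q) = \<i> * complex_of_real (pi * l) + of_nat (n + 2 * q) * \<tau>"
    by (simp add: \<tau> zonal_freq_def field_simps)
  then show "exp (\<tau> * complex_of_real (l + zonal_freq l n q)) = exp (\<i> * complex_of_real (pi * l)) * \<i> ^ n * (-1) ^ q"
    by (simp only: exp_add exp_of_nat_mult e power_add power_mult i_squared mult.assoc power2_i)
  have "\<tau> * complex_of_real (l - zonal_freq l n q) = of_nat (n + 2 * q) * (- \<tau>)"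
    by (simp add: zonal_freq_def algebra_simps)
  then show "exp (\<tau> * complex_of_real (l - zonal_freq l n q)) = (- \<i>) ^ n * (-1) ^ q"
    by (simp only: exp_of_nat_mult e' power_add power_mult) simp
qed

lemma minus_i_power_mult:
  "(- \<i>) ^ n * (\<i> ^ n * c) = c" "(- \<i>) ^ n * ((- \<i>) ^ n * c) = (-1) ^ n * c"
  by (simp_all flip: power_mult_distrib mult.assoc)

text \<open>The sign (-1)^q produced by the quarter turn cancels the one in \<open>zonal_a\<close>,
  leaving unsigned sums that are Beta integrals. The remaining (-1)^n separates the e^(-p u) part
  from the e^(p u) part.\<close>

lemma zonal_a_exp_sums:
  fixes l :: real
  assumes \<tau>: "\<tau> = \<i> * complex_of_real pi / 2"
  defines "\<omega> \<equiv> exp (\<i> * complex_of_real (pi * l))"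
  shows "(\<lambda>N. \<tau> ^ N / fact N * zonal_a l N L n) sums
     ((-1) ^ L / 2 * ((\<omega> + (-1) ^ n) * complex_of_real (\<Sum>q\<le>L. zonal_wt l L n q * zonal_freq l n q)
        - complex_of_real l * (\<omega> - (-1) ^ n) * complex_of_real (\<Sum>q\<le>L. zonal_wt l L n q)))"
proof -
  let ?w = "zonal_wt l L n" and ?v = "zonal_freq l n"
  have "(- \<i>) ^ n * (complex_of_real ((-1) ^ (L + q) * ?w q / 2) *
       (complex_of_real (?v q - l) * exp (\<tau> * complex_of_real (l + ?v q)) + complex_of_real (?v q + l) * exp (\<tau> * complex_of_real (l - ?v q))))
     = (-1) ^ L / 2 * ((\<omega> + (-1) ^ n) * complex_of_real (?w q * ?v q) - complex_of_real l * (\<omega> - (-1) ^ n) * complex_of_real (?w q))"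
    (is "?lhs = ?rhs") for q
  proof -
    have "?lhs = (-1) ^ L / 2 * complex_of_real (?w q) * ((-1) ^ q * (-1) ^ q) *
        (complex_of_real (?v q - l) * \<omega> * ((- \<i>) ^ n * (\<i> ^ n * 1)) + complex_of_real (?v q + l) * ((- \<i>) ^ n * ((- \<i>) ^ n * 1)))"
      unfolding quarter_turn_exp[OF \<tau>] \<omega>_def[symmetric] by (simp add: power_add algebra_simps)
    also have "\<dots> = ?rhs"
      unfolding minus_i_power_mult by (simp add: algebra_simps flip: power_mult_distrib)
    finally show ?thesis .
  qed
  then have "(- \<i>) ^ n * (\<Sum>q\<le>L. complex_of_real ((-1) ^ (L + q) * ?w q / 2) *
       (complex_of_real (?v q - l) * exp (\<tau> * complex_of_real (l + ?v q)) + complex_of_real (?v q + l) * exp (\<tau> * complex_of_real (l - ?v q))))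
     = (-1) ^ L / 2 * ((\<omega> + (-1) ^ n) * complex_of_real (\<Sum>q\<le>L. ?w q * ?v q)
        - complex_of_real l * (\<omega> - (-1) ^ n) * complex_of_real (\<Sum>q\<le>L. ?w q))"
    by (simp only: sum_distrib_left of_real_sum sum_subtractf right_diff_distrib mult.assoc)
  with weighted_exp_sums[of \<tau> "(- \<i>) ^ n" "\<lambda>q. (-1) ^ (L + q) * ?w q / 2" "\<lambda>q. ?v q - l" "\<lambda>q. l + ?v q" "\<lambda>q. ?v q + l" "\<lambda>q. l - ?v q" L]
  show ?thesis by (simp only: zonal_a_def)
qed

lemma zonal_b_exp_sums:
  fixes l :: real
  assumes \<tau>: "\<tau> = \<i> * complex_of_real pi / 2"
  defines "\<omega> \<equiv> exp (\<i> * complex_of_real (pi * l))"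
  shows "(\<lambda>N. \<tau> ^ N / fact N * zonal_b l N L n) sums
     ((-1) ^ L / 2 * ((\<omega> + (-1) ^ n) * complex_of_real (real (Suc n) * (\<Sum>q\<le>L. zonal_wt l L (Suc n) q))))"
proof -
  let ?w = "zonal_wt l L (Suc n)" and ?v = "zonal_freq l (Suc n)"
  have "of_nat (Suc n) * (- \<i>) ^ Suc n * (complex_of_real ((-1) ^ (L + q) * ?w q / 2) *
       (complex_of_real 1 * exp (\<tau> * complex_of_real (l + ?v q)) + complex_of_real (- 1) * exp (\<tau> * complex_of_real (l - ?v q))))
     = (-1) ^ L / 2 * ((\<omega> + (-1) ^ n) * complex_of_real (real (Suc n) * ?w q))"
    (is "?lhs = ?rhs") for q
  proof -
    have "?lhs = (-1) ^ L / 2 * complex_of_real (real (Suc n) * ?w q) * ((-1) ^ q * (-1) ^ q) *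
        (\<omega> * ((- \<i>) ^ Suc n * (\<i> ^ Suc n * 1)) - ((- \<i>) ^ Suc n * ((- \<i>) ^ Suc n * 1)))"
      unfolding quarter_turn_exp[OF \<tau>] \<omega>_def[symmetric] by (simp add: power_add algebra_simps del: of_nat_Suc power_Suc)
    also have "\<dots> = ?rhs"
      \<comment> \<open>The shifted index gives (-1)^(n + 1), and the difference of the two
        exponentials turns it into +(-1)^n.\<close>
      unfolding minus_i_power_mult by (simp add: field_simps flip: power_mult_distrib)
    finally show ?thesis .
  qed
  then have "of_nat (Suc n) * (- \<i>) ^ Suc n * (\<Sum>q\<le>L. complex_of_real ((-1) ^ (L + q) * ?w q / 2) *
       (complex_of_real 1 * exp (\<tau> * complex_of_real (l + ?v q)) + complex_of_real (- 1) * exp (\<tau> * complex_of_real (l - ?v q))))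
     = (-1) ^ L / 2 * ((\<omega> + (-1) ^ n) * complex_of_real (real (Suc n) * (\<Sum>q\<le>L. ?w q)))"
    by (simp only: sum_distrib_left of_real_sum)
  with weighted_exp_sums[of \<tau> "of_nat (Suc n) * (- \<i>) ^ Suc n" "\<lambda>q. (-1) ^ (L + q) * ?w q / 2" "\<lambda>q. 1" "\<lambda>q. l + ?v q" "\<lambda>q. - 1" "\<lambda>q. l - ?v q" L]
  show ?thesis by (simp only: zonal_b_def mult_1 mult_minus1 diff_conv_add_uminus)
qed

section \<open>The sums over q as Beta sums\<close>

lemma sum_zonal_wt:
  "(\<Sum>q\<le>L. zonal_wt l L n q) = beta_sum L (l + real n) / (4 ^ L * fact n * fact L)"
proof -
  have *: "real n + real q + l = l + real n + real q" for q by simp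
  show ?thesis
    unfolding zonal_wt_def beta_sum_def sum_divide_distrib *
    by (intro sum.cong refl) (simp add: mult_ac)
qed

text \<open>Without signs the two parts of \<open>binomial_pochhammer_split\<close> add up: after an
  index shift both are the same Beta sum, of order L - 1 and with parameter raised by one. The case
  L = 0 produces the pure exponential outside the integrals.\<close>

lemma sum_zonal_wt_freq:
  assumes l: "l > 0"
  shows "(\<Sum>q\<le>L. zonal_wt l L n q * zonal_freq l n q) =
    (if L = 0 then 1 / fact n else 2 * beta_sum (L - 1) (l + 1 + real n) / (4 ^ L * fact n * fact L))"
proof (cases L)
  case 0
  have "real n + l > 0" using l by simp
  then show ?thesis using 0 by (simp add: zonal_wt_def zonal_freq_def)
next
  case (Suc K)
  let ?a = "l + real n"
  have a: "?a > 0" using l by simp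
  have "(\<Sum>q\<le>L. zonal_wt l L n q * zonal_freq l n q) =
     (\<Sum>q\<le>Suc K. 1 / (4 ^ L * fact n * fact L) * (of_nat (Suc K choose q) * (?a + 2 * real q) / pochhammer (?a + real q) (Suc (Suc K))))"
  proof (intro sum.cong)
    fix q :: nat
    have *: "zonal_freq l n q = ?a + 2 * real q" "real n + real q + l = ?a + real q" by (simp_all add: zonal_freq_def)
    show "zonal_wt l L n q * zonal_freq l n q = 1 / (4 ^ L * fact n * fact L) *
        (of_nat (Suc K choose q) * (?a + 2 * real q) / pochhammer (?a + real q) (Suc (Suc K)))"
      unfolding zonal_wt_def Suc * by simp
  qed (simp add: Suc)
  also have "\<dots> = 1 / (4 ^ L * fact n * fact L) * ((\<Sum>q\<le>Suc K. of_nat (K choose q) / pochhammer (?a + real q + 1) (Suc K)) +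
     (\<Sum>q\<le>Suc K. if q = 0 then 0 else of_nat (K choose (q - 1)) / pochhammer (?a + real q) (Suc K)))"
    unfolding binomial_pochhammer_split[OF a] by (simp only: sum_distrib_left[symmetric] sum.distrib)
  also have "(\<Sum>q\<le>Suc K. of_nat (K choose q) / pochhammer (?a + real q + 1) (Suc K)) = beta_sum K (l + 1 + real n)"
    unfolding beta_sum_def by (simp add: algebra_simps)
  also have "(\<Sum>q\<le>Suc K. if q = 0 then 0 else of_nat (K choose (q - 1)) / pochhammer (?a + real q) (Suc K)) = beta_sum K (l + 1 + real n)"
    unfolding beta_sum_def by (subst sum.atMost_Suc_shift) (simp add: algebra_simps)
  finally show ?thesis using Suc by simp
qed

section \<open>Bessel and exponential series under the integral\<close>

lemma summable_even_powers_fact: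
  fixes r :: real
  shows "summable (\<lambda>k. (r / 2) ^ (2 * k) / fact k)"
  using summable_exp[of "(r / 2)\<^sup>2"] unfolding power_mult
  by (rule back_subst[where P = summable]) (simp add: fun_eq_iff inverse_eq_divide)

lemma abs_signed_term:
  fixes X F :: real
  assumes "X \<ge> 0" "F > 0"
  shows "norm \<bar>(-1) ^ k / F * X\<bar> = X / F"
  using assms by (simp add: abs_mult)

lemma summable_bessel_J0: "summable (\<lambda>k. \<bar>(-1) ^ k / (fact k * fact k) * (r / 2) ^ (2 * k)\<bar> :: real)"
proof (rule summable_comparison_test'[OF summable_even_powers_fact])
  fix k :: nat
  have "(r / 2) ^ (2 * k) / (fact k * fact k) \<le> (r / 2) ^ (2 * k) / fact k"
    by (intro divide_left_mono) (auto simp: power_mult)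
  then show "norm \<bar>(-1) ^ k / (fact k * fact k) * (r / 2) ^ (2 * k)\<bar> \<le> (r / 2) ^ (2 * k) / fact k"
    by (subst abs_signed_term) (auto simp: power_mult)
qed

lemma summable_bessel_J1:
  "summable (\<lambda>k. \<bar>(-1) ^ k / (fact k * fact (k + 1)) * (r / 2) ^ (2 * k + 1)\<bar> :: real)"
proof (rule summable_comparison_test'[OF summable_mult[OF summable_even_powers_fact]])
  fix k :: nat
  have "(r / 2) ^ (2 * k) / (fact k * fact (k + 1)) \<le> (r / 2) ^ (2 * k) / fact k"
    using fact_ge_1[of "k + 1", where 'a = real]
    by (intro divide_left_mono) (auto simp: power_mult simp del: fact_Suc)
  then have le: "\<bar>r / 2\<bar> * ((r / 2) ^ (2 * k) / (fact k * fact (k + 1))) \<le> \<bar>r / 2\<bar> * ((r / 2) ^ (2 * k) / fact k)"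
    by (intro mult_left_mono) auto
  show "norm \<bar>(-1) ^ k / (fact k * fact (k + 1)) * (r / 2) ^ (2 * k + 1)\<bar> \<le> \<bar>r / 2\<bar> * ((r / 2) ^ (2 * k) / fact k)"
  proof -
    have "norm \<bar>(-1) ^ k / (fact k * fact (k + 1)) * (r / 2) ^ (2 * k + 1)\<bar> =
        \<bar>r / 2\<bar> * norm \<bar>(-1) ^ k / (fact k * fact (k + 1)) * (r / 2) ^ (2 * k)\<bar>"
      unfolding power_add by (simp only: abs_mult real_norm_def abs_abs power_one_right mult_ac)
    also have "\<dots> = \<bar>r / 2\<bar> * ((r / 2) ^ (2 * k) / (fact k * fact (k + 1)))"
      by (subst abs_signed_term) (auto simp: power_mult simp del: fact_Suc)
    finally show "norm \<bar>(-1) ^ k / (fact k * fact (k + 1)) * (r / 2) ^ (2 * k + 1)\<bar> \<le> \<bar>r / 2\<bar> * ((r / 2) ^ (2 * k) / fact k)"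
      using le by (simp only:)
  qed
qed

lemma summable_exp_series: "summable (\<lambda>n. \<bar>x ^ n / fact n\<bar> :: real)"
  using summable_exp[of "\<bar>x\<bar>"]
  by (rule back_subst[where P = summable]) (simp add: fun_eq_iff inverse_eq_divide power_abs)

lemma exp_series: "(\<Sum>n. x ^ n / fact n * u ^ n) = exp (x * u :: real)"
  by (simp add: exp_def power_mult_distrib divide_inverse mult_ac)

lemma bessel_J0_series:
  assumes "v \<ge> 0"
  shows "bessel_J 0 (r * v powr (1/2)) = (\<Sum>k. (-1) ^ k / (fact k * fact k) * (r / 2) ^ (2 * k) * v ^ k)"
proof -
  have "(r * v powr (1/2) / 2) ^ (2 * k) = (r / 2) ^ (2 * k) * v ^ k" for k
    using assms by (simp add: powr_half_sqrt power_mult power_mult_distrib power_divide)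
  then show ?thesis by (simp add: bessel_J_def mult.assoc)
qed

text \<open>The factor v^(-1/2) removes the half-integer powers of v. At v = 0 the series has the
  value r/2, but \<open>powr\<close> returns 0, hence v > 0.\<close>

lemma bessel_J1_series:
  assumes "v > 0" "v \<le> 1"
  shows "v powr (-1/2) * bessel_J 1 (r * v powr (1/2)) =
    (\<Sum>k. (-1) ^ k / (fact k * fact (k + 1)) * (r / 2) ^ (2 * k + 1) * v ^ k)"
proof -
  let ?c = "\<lambda>k. (-1) ^ k / (fact k * fact (k + 1)) * (r / 2) ^ (2 * k + 1)"
  have e: "(r * v powr (1/2) / 2) ^ (2 * k + 1) = v powr (1/2) * ((r / 2) ^ (2 * k + 1) * v ^ k)" for k
    using assms by (simp add: powr_half_sqrt power_mult power_mult_distrib power_divide)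
  have "summable (\<lambda>k. ?c k * v ^ k)"
  proof (rule summable_comparison_test'[OF summable_bessel_J1])
    fix k :: nat
    show "norm (?c k * v ^ k) \<le> \<bar>?c k\<bar>"
      using mult_left_mono[OF power_le_one[of v k], of "\<bar>?c k\<bar>"] assms by (simp add: abs_mult)
  qed
  then have "v powr (1/2) * (\<Sum>k. ?c k * v ^ k) = (\<Sum>k. v powr (1/2) * (?c k * v ^ k))"
    by (rule suminf_mult[symmetric])
  also have "\<dots> = bessel_J 1 (r * v powr (1/2))"
    unfolding bessel_J_def e by (simp add: mult_ac)
  finally have "bessel_J 1 (r * v powr (1/2)) = v powr (1/2) * (\<Sum>k. ?c k * v ^ k)" ..
  moreover have "v powr (-1/2) * v powr (1/2) = 1"
    using assms by (simp flip: powr_add)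
  ultimately show ?thesis by (simp only: mult.assoc[symmetric] mult_1)
qed

lemma half_power_even: "(r / 2) ^ (2 * k) = (r\<^sup>2) ^ k / (4 :: real) ^ k"
  by (simp add: power_divide power_mult)

lemma tendsto_bessel_J0_integral:
  fixes a r p :: real
  assumes a: "a > 0" and M: "filterlim M at_top sequentially" and M': "filterlim M' at_top sequentially"
  shows "(\<lambda>K. \<Sum>L<M K. \<Sum>n<M' K. (-1) ^ L * (r\<^sup>2) ^ L * p ^ n * (beta_sum L (a + real n) / (4 ^ L * fact n * fact L)))
    \<longlonglongrightarrow> integral {0..1} (\<lambda>u. bessel_J 0 (r * (1 - u\<^sup>2) powr (1/2)) * u powr (a - 1) * exp (p * u))"
proof -
  have c: "(-1) ^ L / (fact L * fact L) * (r / 2) ^ (2 * L) * (p ^ n / fact n) * (fact L * b)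
       = (-1) ^ L * (r\<^sup>2) ^ L * p ^ n * (b / (4 ^ L * fact n * fact L))" for L n and b :: real
    unfolding half_power_even by (simp add: mult_ac)
  have i: "u powr (a - 1) * (\<Sum>L. (-1) ^ L / (fact L * fact L) * (r / 2) ^ (2 * L) * (1 - u\<^sup>2) ^ L) * (\<Sum>n. p ^ n / fact n * u ^ n)
      = bessel_J 0 (r * (1 - u\<^sup>2) powr (1/2)) * u powr (a - 1) * exp (p * u)" if "u \<in> {0..1}" for u
  proof -
    have v: "1 - u\<^sup>2 \<ge> 0" using that by (simp add: power_le_one)
    show ?thesis unfolding bessel_J0_series[OF v] exp_series by (simp only: mult_ac)
  qed
  have "integral {0..1} (\<lambda>u. u powr (a - 1) * (\<Sum>L. (-1) ^ L / (fact L * fact L) * (r / 2) ^ (2 * L) * (1 - u\<^sup>2) ^ L) *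
          (\<Sum>n. p ^ n / fact n * u ^ n))
      = integral {0..1} (\<lambda>u. bessel_J 0 (r * (1 - u\<^sup>2) powr (1/2)) * u powr (a - 1) * exp (p * u))"
    by (rule integral_cong) (rule i)
  with tendsto_integral_double_series[OF a summable_bessel_J0[of r] summable_exp_series[of p] M M']
  show ?thesis unfolding c by simp
qed

text \<open>The factor -r completes the odd power of r in the J_1 series to (r^2)^(L + 1) and shifts
  its sign, so its L-th term matches degree L + 1 in \<rho>.\<close>

lemma tendsto_bessel_J1_integral:
  fixes a r p :: real
  assumes a: "a > 0" and M: "filterlim M at_top sequentially" and M': "filterlim M' at_top sequentially"
  shows "(\<lambda>K. \<Sum>L<M K. \<Sum>n<M' K. (-1) ^ Suc L * (r\<^sup>2) ^ Suc L * p ^ n *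
        (2 * beta_sum L (a + real n) / (4 ^ Suc L * fact n * fact (Suc L))))
    \<longlonglongrightarrow> - r * integral {0..1} (\<lambda>u. (1 - u\<^sup>2) powr (-1/2) * bessel_J 1 (r * (1 - u\<^sup>2) powr (1/2))
         * u powr (a - 1) * exp (p * u))"
proof -
  have c: "- r * ((-1) ^ L / (fact L * fact (L + 1)) * (r / 2) ^ (2 * L + 1) * (p ^ n / fact n) * (fact L * b))
       = (-1) ^ Suc L * (r\<^sup>2) ^ Suc L * p ^ n * (2 * b / (4 ^ Suc L * fact n * fact (Suc L)))" for L n and b :: real
    unfolding power_add half_power_even power_one_right power_Suc
    by (simp add: mult_ac power2_eq_square[of r] del: fact_Suc)
  have "integral {0..1} (\<lambda>u. u powr (a - 1) * (\<Sum>L. (-1) ^ L / (fact L * fact (L + 1)) * (r / 2) ^ (2 * L + 1) * (1 - u\<^sup>2) ^ L) *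
           (\<Sum>n. p ^ n / fact n * u ^ n))
      = integral {0..1} (\<lambda>u. (1 - u\<^sup>2) powr (-1/2) * bessel_J 1 (r * (1 - u\<^sup>2) powr (1/2)) * u powr (a - 1) * exp (p * u))"
  \<comment> \<open>The point u = 1 is where 1 - u^2 = 0 and the series identity breaks
    down.\<close>
  proof (rule integral_spike[where S = "{1}"])
    fix u :: real assume u: "u \<in> {0..1} - {1}"
    then have v: "1 - u\<^sup>2 > 0" "1 - u\<^sup>2 \<le> 1" by (auto simp: abs_square_less_1)
    show "(1 - u\<^sup>2) powr (-1/2) * bessel_J 1 (r * (1 - u\<^sup>2) powr (1/2)) * u powr (a - 1) * exp (p * u) =
      u powr (a - 1) * (\<Sum>L. (-1) ^ L / (fact L * fact (L + 1)) * (r / 2) ^ (2 * L + 1) * (1 - u\<^sup>2) ^ L) * (\<Sum>n. p ^ n / fact n * u ^ n)"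
      unfolding bessel_J1_series[OF v, symmetric] exp_series by (simp only: mult_ac)
  qed auto
  with tendsto_mult_left[OF tendsto_integral_double_series[OF a summable_bessel_J1[of r] summable_exp_series[of p] M M'], of "- r"]
  show ?thesis unfolding sum_distrib_left c by simp
qed

text \<open>The row L = 0 sums to exp p; the other rows form the J_1 series. Taking K + 1 rows
  leaves a K by K square once that row is split off.\<close>

lemma tendsto_even_part:
  fixes l r p :: real
  assumes l: "l > 0"
  shows "(\<lambda>K. \<Sum>L<Suc K. \<Sum>n<K. (-1) ^ L * (r\<^sup>2) ^ L * p ^ n * (\<Sum>q\<le>L. zonal_wt l L n q * zonal_freq l n q))
    \<longlonglongrightarrow> exp p - r * integral {0..1} (\<lambda>u. (1 - u\<^sup>2) powr (-1/2) * bessel_J 1 (r * (1 - u\<^sup>2) powr (1/2))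
         * u powr l * exp (p * u))"
proof -
  have "(\<lambda>K. \<Sum>n<K. p ^ n / fact n) \<longlonglongrightarrow> exp p"
    using exp_converges[of p] by (simp add: sums_def divide_inverse mult.commute)
  moreover have "l + 1 > 0" using l by simp
  note tendsto_bessel_J1_integral[OF this filterlim_ident filterlim_ident, of r p]
  ultimately have "(\<lambda>K. (\<Sum>n<K. p ^ n / fact n) + (\<Sum>L<K. \<Sum>n<K. (-1) ^ Suc L * (r\<^sup>2) ^ Suc L * p ^ n *
        (2 * beta_sum L (l + 1 + real n) / (4 ^ Suc L * fact n * fact (Suc L)))))
    \<longlonglongrightarrow> exp p + - r * integral {0..1} (\<lambda>u. (1 - u\<^sup>2) powr (-1/2) * bessel_J 1 (r * (1 - u\<^sup>2) powr (1/2))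
         * u powr (l + 1 - 1) * exp (p * u))"
    by (rule tendsto_add)
  then show ?thesis
    unfolding sum.lessThan_Suc_shift sum_zonal_wt_freq[OF l] by (simp del: fact_Suc power_Suc)
qed

section \<open>The kernel formula\<close>

theorem theorem6:
  fixes m :: nat and x y :: "nat \<Rightarrow> real"
  assumes "m \<ge> 3"
  shows "let p = vinner m x y; r = vnorm m x * vnorm m y;
           I1 = (\<lambda>s. integral {0..1} (\<lambda>u. (1 - u\<^sup>2) powr (-1/2) * bessel_J 1 (r * (1 - u\<^sup>2) powr (1/2))
                      * u powr (real m / 2 - 1) * exp (s * p * u)));
           I0 = (\<lambda>s. integral {0..1} (\<lambda>u. bessel_J 0 (r * (1 - u\<^sup>2) powr (1/2))
                      * u powr (real m / 2 - 2) * exp (s * p * u)));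
           I0' = (\<lambda>s. integral {0..1} (\<lambda>u. bessel_J 0 (r * (1 - u\<^sup>2) powr (1/2))
                      * u powr (real m / 2 - 1) * exp (s * p * u)));
           W = cl_wedge m x y;
           K = cl_sub
                 (cl_add (cl_scalar (complex_of_real (exp (- p) / 2 - r / 2 * I1 (-1) + (real m - 2) / 4 * I0 (-1))))
                         (cl_smult (complex_of_real (1/2 * I0' (-1))) W))
                 (cl_smult (exp (\<i> * of_nat m * complex_of_real pi / 2))
                   (cl_add (cl_scalar (complex_of_real (exp p / 2 - r / 2 * I1 1 - (real m - 2) / 4 * I0 1)))
                           (cl_smult (complex_of_real (1/2 * I0' 1)) W)))
         in \<forall>A. (\<lambda>n. exp_Gamma_term m (\<lambda>z. cl_scalar (exp (- \<i> * complex_of_real (vinner m x z)))) y n A)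
                 sums K A"
proof -
  define l where "l = real m / 2 - 1"
  have l: "l > 0" using assms by (simp add: l_def)
  define p where "p = vinner m x y"
  define r where "r = vnorm m x * vnorm m y"
  define \<rho> where "\<rho> = complex_of_real (vinner m x x * vinner m y y)"
  have \<rho>: "\<rho> = complex_of_real (r\<^sup>2)"
    by (simp add: \<rho>_def r_def vnorm_def vinner_def power_mult_distrib sum_nonneg flip: power2_eq_square)
  define \<tau> where "\<tau> = \<i> * complex_of_real pi / 2"
  define \<omega> where "\<omega> = exp (\<i> * complex_of_real (pi * l))"
  \<comment> \<open>Since m/2 = l + 1, the prefactor is -\<omega>, and the minus sign in front of
    the second bracket becomes a plus.\<close>
  have \<omega>: "exp (\<i> * of_nat m * complex_of_real pi / 2) = - \<omega>"
  proof -
    have *: "\<i> * of_nat m * complex_of_real pi / 2 = \<i> * complex_of_real (pi * l) + \<i> * complex_of_real pi"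
      by (simp add: l_def field_simps)
    show ?thesis unfolding * exp_add \<omega>_def by (simp add: mult.commute)
  qed
  define I1 where "I1 s = integral {0..1} (\<lambda>u. (1 - u\<^sup>2) powr (-1/2) * bessel_J 1 (r * (1 - u\<^sup>2) powr (1/2))
                      * u powr (real m / 2 - 1) * exp (s * p * u))" for s
  define I0 where "I0 s = integral {0..1} (\<lambda>u. bessel_J 0 (r * (1 - u\<^sup>2) powr (1/2))
                      * u powr (real m / 2 - 2) * exp (s * p * u))" for s
  define J0 where "J0 s = integral {0..1} (\<lambda>u. bessel_J 0 (r * (1 - u\<^sup>2) powr (1/2))
                      * u powr (real m / 2 - 1) * exp (s * p * u))" for s
  let ?A = "\<lambda>N L. fst (Gamma_fps m N L)" and ?B = "\<lambda>N L. snd (Gamma_fps m N L)"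
  let ?p = "complex_of_real p"
  define Sa where "Sa N = (\<Sum>L\<le>N. \<rho> ^ L * eval_fps (?A N L) ?p)" for N
  define Sb where "Sb N = (\<Sum>L\<le>N. \<rho> ^ L * eval_fps (?B N L) ?p)" for N
  have nth: "fps_nth (?A N L) n = zonal_a l N L n" "fps_nth (?B N L) n = zonal_b l N L n" for N L n
    using Gamma_fps_nth[OF l_def l] by auto
  have rowa: "(\<lambda>n. zonal_a l N L n * ?p ^ n) sums eval_fps (?A N L) ?p"
    and rowb: "(\<lambda>n. zonal_b l N L n * ?p ^ n) sums eval_fps (?B N L) ?p" for N L
    using sums_eval_fps[of ?p "?A N L"] sums_eval_fps[of ?p "?B N L"] Gamma_fps_conv_radius[of m N L]
    by (simp_all add: nth)
  have lim_Suc: "filterlim Suc at_top sequentially" by (rule filterlim_Suc)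
  have lim_id: "filterlim (\<lambda>K::nat. K) at_top sequentially" by (rule filterlim_ident)
  have nonneg: "0 \<le> 1 / l" "0 \<le> 2 * l + 2" "(0::real) \<le> 2" "(0::real) \<le> 4"
    using l by simp_all
  \<comment> \<open>The parameter s is 1 or -1: powers of s p absorb the signs (-1)^n, so each
    series is treated once for both exponentials.\<close>
  define P1 where "P1 s L n = (-1) ^ L * (r\<^sup>2) ^ L * (s * p) ^ n * (\<Sum>q\<le>L. zonal_wt l L n q * zonal_freq l n q)" for s L n
  define P0 where "P0 s L n = (-1) ^ L * (r\<^sup>2) ^ L * (s * p) ^ n * (\<Sum>q\<le>L. zonal_wt l L n q)" for s L n
  define Q0 where "Q0 s L n = (-1) ^ L * (r\<^sup>2) ^ L * (s * p) ^ n * (real (Suc n) * (\<Sum>q\<le>L. zonal_wt l L (Suc n) q))" for s L n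

  have Sa: "(\<lambda>N. \<tau> ^ N / fact N * Sa N) sums (complex_of_real (exp (- p) / 2 - r / 2 * I1 (-1) + l / 2 * I0 (-1))
      + \<omega> * complex_of_real (exp p / 2 - r / 2 * I1 1 - l / 2 * I0 1))"
    (is "_ sums ?z")
  proof -
    have e0: "eval_fps (?A N L) ?p = 0" if "N < L" for N L
      using that by (simp add: Gamma_fps_eq_0)
    note interchange = exponential_type_interchange[where r = \<rho>, OF nonneg norm_zonal_a_le[OF l] rowa e0 zonal_a_exp_sums[OF \<tau>_def]]
    have "\<exists>Z. (\<lambda>N. \<tau> ^ N / fact N * Sa N) sums Z \<and> ((\<lambda>(L, n). \<rho> ^ L * ?p ^ n * ((-1) ^ L / 2 * ((\<omega> + (-1) ^ n) * complex_of_real (\<Sum>q\<le>L. zonal_wt l L n q * zonal_freq l n q)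
        - complex_of_real l * (\<omega> - (-1) ^ n) * complex_of_real (\<Sum>q\<le>L. zonal_wt l L n q)))) has_sum Z) UNIV"
      unfolding Sa_def \<omega>_def by (rule interchange, assumption) (intro exI conjI)
    then obtain Z where Z: "(\<lambda>N. \<tau> ^ N / fact N * Sa N) sums Z"
      and hs: "((\<lambda>(L, n). \<rho> ^ L * ?p ^ n * ((-1) ^ L / 2 * ((\<omega> + (-1) ^ n) * complex_of_real (\<Sum>q\<le>L. zonal_wt l L n q * zonal_freq l n q)
        - complex_of_real l * (\<omega> - (-1) ^ n) * complex_of_real (\<Sum>q\<le>L. zonal_wt l L n q)))) has_sum Z) UNIV"
      by blast
    have summand: "\<rho> ^ L * ?p ^ n * ((-1) ^ L / 2 * ((\<omega> + (-1) ^ n) * complex_of_real (\<Sum>q\<le>L. zonal_wt l L n q * zonal_freq l n q)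
        - complex_of_real l * (\<omega> - (-1) ^ n) * complex_of_real (\<Sum>q\<le>L. zonal_wt l L n q)))
      = (\<omega> * complex_of_real (P1 1 L n) + complex_of_real (P1 (-1) L n)) / 2
       - complex_of_real l / 2 * (\<omega> * complex_of_real (P0 1 L n) - complex_of_real (P0 (-1) L n))" for L n
      unfolding P1_def P0_def \<rho> power_mult_distrib by (simp add: field_simps)
    have "(\<lambda>K. \<Sum>L<Suc K. \<Sum>n<K. (\<omega> * complex_of_real (P1 1 L n) + complex_of_real (P1 (-1) L n)) / 2
       - complex_of_real l / 2 * (\<omega> * complex_of_real (P0 1 L n) - complex_of_real (P0 (-1) L n))) \<longlonglongrightarrow> Z"
      using has_sum_rectangles[OF hs lim_Suc lim_id] unfolding summand .
    also have "(\<lambda>K. \<Sum>L<Suc K. \<Sum>n<K. (\<omega> * complex_of_real (P1 1 L n) + complex_of_real (P1 (-1) L n)) / 2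
       - complex_of_real l / 2 * (\<omega> * complex_of_real (P0 1 L n) - complex_of_real (P0 (-1) L n))) =
       (\<lambda>K. (\<omega> * complex_of_real (\<Sum>L<Suc K. \<Sum>n<K. P1 1 L n) + complex_of_real (\<Sum>L<Suc K. \<Sum>n<K. P1 (-1) L n)) / 2
       - complex_of_real l / 2 * (\<omega> * complex_of_real (\<Sum>L<Suc K. \<Sum>n<K. P0 1 L n) - complex_of_real (\<Sum>L<Suc K. \<Sum>n<K. P0 (-1) L n)))"
      by (simp only: sum_subtractf sum.distrib of_real_sum sum_distrib_left[symmetric] sum_divide_distrib[symmetric])
    finally have limZ: "\<dots> \<longlonglongrightarrow> Z" .
    have lims: "(\<lambda>K. \<Sum>L<Suc K. \<Sum>n<K. P1 s L n) \<longlonglongrightarrow> exp (s * p) - r * I1 s" for s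
      using tendsto_even_part[OF l, of r "s * p"] unfolding P1_def I1_def l_def .
    \<comment> \<open>Here the Beta parameter is l itself, giving u^(m/2 - 2); integrability at 0 is
      the condition l > 0, that is, m \<ge> 3.\<close>
    have lims': "(\<lambda>K. \<Sum>L<Suc K. \<Sum>n<K. P0 s L n) \<longlonglongrightarrow> I0 s" for s
      using tendsto_bessel_J0_integral[OF l lim_Suc lim_id, of r "s * p"]
      unfolding P0_def I0_def sum_zonal_wt by (simp add: l_def)
    from limZ have "Z = (\<omega> * complex_of_real (exp (1 * p) - r * I1 1) + complex_of_real (exp ((-1) * p) - r * I1 (-1))) / 2
       - complex_of_real l / 2 * (\<omega> * complex_of_real (I0 1) - complex_of_real (I0 (-1)))"
      by (rule LIMSEQ_unique) (intro tendsto_intros lims lims', simp)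
    also have "\<dots> = ?z" by (simp add: field_simps)
    finally have "Z = ?z" .
    with Z show ?thesis by simp
  qed

  have Sb: "(\<lambda>N. \<tau> ^ N / fact N * Sb N) sums (complex_of_real (1/2 * J0 (-1)) + \<omega> * complex_of_real (1/2 * J0 1))"
    (is "_ sums ?z")
  proof -
    have e0: "eval_fps (?B N L) ?p = 0" if "N < L" for N L
      using that by (simp add: Gamma_fps_eq_0)
    note interchange = exponential_type_interchange[where r = \<rho>, OF nonneg norm_zonal_b_le[OF l] rowb e0 zonal_b_exp_sums[OF \<tau>_def]]
    have "\<exists>Z. (\<lambda>N. \<tau> ^ N / fact N * Sb N) sums Z \<and> ((\<lambda>(L, n). \<rho> ^ L * ?p ^ n * ((-1) ^ L / 2 * ((\<omega> + (-1) ^ n) *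
            complex_of_real (real (Suc n) * (\<Sum>q\<le>L. zonal_wt l L (Suc n) q))))) has_sum Z) UNIV"
      unfolding Sb_def \<omega>_def by (rule interchange, assumption) (intro exI conjI)
    then obtain Z where Z: "(\<lambda>N. \<tau> ^ N / fact N * Sb N) sums Z"
      and hs: "((\<lambda>(L, n). \<rho> ^ L * ?p ^ n * ((-1) ^ L / 2 * ((\<omega> + (-1) ^ n) *
            complex_of_real (real (Suc n) * (\<Sum>q\<le>L. zonal_wt l L (Suc n) q))))) has_sum Z) UNIV"
      by blast
    have summand: "\<rho> ^ L * ?p ^ n * ((-1) ^ L / 2 * ((\<omega> + (-1) ^ n) *
            complex_of_real (real (Suc n) * (\<Sum>q\<le>L. zonal_wt l L (Suc n) q))))
      = (\<omega> * complex_of_real (Q0 1 L n) + complex_of_real (Q0 (-1) L n)) / 2" for L n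
      unfolding Q0_def \<rho> power_mult_distrib by (simp add: field_simps)
    have "(\<lambda>K. \<Sum>L<Suc K. \<Sum>n<K. (\<omega> * complex_of_real (Q0 1 L n) + complex_of_real (Q0 (-1) L n)) / 2) \<longlonglongrightarrow> Z"
      using has_sum_rectangles[OF hs lim_Suc lim_id] unfolding summand .
    also have "(\<lambda>K. \<Sum>L<Suc K. \<Sum>n<K. (\<omega> * complex_of_real (Q0 1 L n) + complex_of_real (Q0 (-1) L n)) / 2) =
       (\<lambda>K. (\<omega> * complex_of_real (\<Sum>L<Suc K. \<Sum>n<K. Q0 1 L n) + complex_of_real (\<Sum>L<Suc K. \<Sum>n<K. Q0 (-1) L n)) / 2)"
      by (simp only: sum.distrib of_real_sum sum_distrib_left[symmetric] sum_divide_distrib[symmetric])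
    finally have limZ: "\<dots> \<longlonglongrightarrow> Z" .
    have lims: "(\<lambda>K. \<Sum>L<Suc K. \<Sum>n<K. Q0 s L n) \<longlonglongrightarrow> J0 s" for s
    proof -
      have "l + 1 > 0" using l by simp
      note lim = tendsto_bessel_J0_integral[OF this lim_Suc lim_id, of r "s * p"]
      \<comment> \<open>The factor n + 1 reduces (n + 1)! to n!, while the shifted index raises the
        Beta parameter to l + 1; this gives the exponent m/2 - 1.\<close>
      have w: "real (Suc n) * (beta_sum L b / (4 ^ L * fact (Suc n) * fact L)) = beta_sum L b / (4 ^ L * fact n * fact L)" for L n b
        by (simp add: divide_simps del: of_nat_Suc)
      have shift: "l + real (Suc n) = l + 1 + real n" "l + 1 - 1 = real m / 2 - 1" for n by (simp_all add: l_def)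
      show ?thesis
        using lim unfolding Q0_def J0_def sum_zonal_wt shift w .
    qed
    from limZ have "Z = (\<omega> * complex_of_real (J0 1) + complex_of_real (J0 (-1))) / 2"
      by (rule LIMSEQ_unique) (intro tendsto_intros lims, simp)
    also have "\<dots> = ?z" by (simp add: field_simps)
    finally have "Z = ?z" .
    with Z show ?thesis by simp
  qed

  have "(\<lambda>N. exp_Gamma_term m (\<lambda>z. cl_scalar (exp (- \<i> * complex_of_real (vinner m x z)))) y N C) sums
      cl_sub (cl_add (cl_scalar (complex_of_real (exp (- p) / 2 - r / 2 * I1 (-1) + (real m - 2) / 4 * I0 (-1))))
                         (cl_smult (complex_of_real (1/2 * J0 (-1))) (cl_wedge m x y)))
                 (cl_smult (exp (\<i> * of_nat m * complex_of_real pi / 2))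
                   (cl_add (cl_scalar (complex_of_real (exp p / 2 - r / 2 * I1 1 - (real m - 2) / 4 * I0 1)))
                           (cl_smult (complex_of_real (1/2 * J0 1)) (cl_wedge m x y)))) C" (is "?f sums ?v") for C
  proof -
    have f: "?f = (\<lambda>N. \<tau> ^ N / fact N * Sa N * cl_one C + \<tau> ^ N / fact N * Sb N * cl_wedge m x y C)"
      unfolding exp_Gamma_term_def Gamma_op_power Sa_def Sb_def \<tau>_def \<rho>_def p_def
      by (simp only: cl_smult_def cl_add_def fun_eq_iff) (simp add: cl_scalar_def algebra_simps)
    have "(real m - 2) / 4 = l / 2" by (simp add: l_def)
    then have v: "?v = (complex_of_real (exp (- p) / 2 - r / 2 * I1 (-1) + l / 2 * I0 (-1))
      + \<omega> * complex_of_real (exp p / 2 - r / 2 * I1 1 - l / 2 * I0 1)) * cl_one C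
      + (complex_of_real (1/2 * J0 (-1)) + \<omega> * complex_of_real (1/2 * J0 1)) * cl_wedge m x y C"
      by (cases "C = {}") (simp_all only: \<omega> cl_sub_def cl_add_def cl_smult_def cl_scalar_def, simp_all add: algebra_simps)
    show ?thesis unfolding f v by (intro sums_add sums_mult2 Sa Sb)
  qed
  then show ?thesis
    unfolding Let_def p_def[symmetric] r_def[symmetric] I1_def[symmetric] I0_def[symmetric] J0_def[symmetric] by blast
qed

end
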